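(* Let $u\in C^2(\bar\Omega)$ be admissible, i.e. $M[u]\in\Gamma$ in $\bar\Omega$, and let $\bar u\in C^2(\bar\Omega)$ be admissible with respect to $u$, i.e. $M_u[\bar u]\in\Gamma$ in $\bar\Omega$. Assume that $F_r>0$ in $\Gamma$ (condition F1) and that $A$ is regular. (i) Suppose that either (a) $F$ is concave in $\Gamma$ (condition F2), or (b) $M_u[\bar u]\in K^+\subset\Gamma$ in $\bar\Omega$ and, for every $\mu>0$, there is a constant $C_\mu$ such that $$ r\cdot F_r(r)\le F(r)+\mu\,\mathcal T(r)+C_\mu\quad\text{for all } r\in\Gamma .$$ Then there are positive constants $K,\delta,C,C'$, depending on $n,F,\Omega,A,\bar u$ and $|u|_{1;\Omega}$, such that $$ L e^{K(\bar u-u)}\ \ge\ \delta\,\mathcal T-C\,\mathcal F[u]-C'\quad\text{in }\Omega .$$ (ii) Suppose that $u$ is a supersolution of the equation, i.e. $\mathcal F[u]\le B(\cdot,u,Du)$ in $\Omega$, that $B$ is convex in $p$, that $F$ is concave in $\Gamma$ (F2), and that $\bar u$ satisfies the subsolution condition $F(M_u[\bar u])\ge B(\cdot,u,D\bar u)$ in $\Omega$. Then there are positive constants $K,\delta$, depending on $n,F,\Omega,A,B,\bar u$ and $|u|_{1;\Omega}$, such that, with $\eta=e^{K(\bar u-u)}$, $$ \mathcal L\eta\ \ge\ \delta(\mathcal T+1)\quad\text{in }\Omega .$$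
   Context: $\Omega\subset\mathbb R^n$ is a bounded domain; $\mathbb S^n$ is the space of real symmetric $n\times n$ matrices; $K^+\subset\mathbb S^n$ is the cone of positive definite matrices. $\Gamma\subset\mathbb S^n$ is an open convex set which contains $K^+$ and is closed under addition of elements of $K^+$. $F\in C^1(\Gamma)$ is real valued, $F_r=[F_{r_{ij}}]$, $\mathcal T(r)=\operatorname{trace}F_r(r)$, and $r\cdot F_r=\sum r_{ij}F_{r_{ij}}(r)$. $A:\bar\Omega\times\mathbb R\times\mathbb R^n\to\mathbb S^n$, $(x,z,p)\mapsto A(x,z,p)$, is continuous and twice differentiable in $p$ with $D_p^2A$ continuous. Write $A^k_{ij}=D_{p_k}A_{ij}$, $A^{kl}_{ij}=D^2_{p_kp_l}A_{ij}$. $A$ is regular if $\sum A^{kl}_{ij}(x,z,p)\xi_i\xi_j\eta_k\eta_l\ge0$ for all $(x,z,p)$ and all $\xi,\eta\in\mathbb R^n$ with $\xi\cdot\eta=0$. $B:\bar\Omega\times\mathbb R\times\mathbb R^n\to\mathbb R$ is continuous, differentiable in $p$, with $D_pB$ continuous. $M[u]=D^2u-A(\cdot,u,Du)$, $\mathcal F[u]=F(M[u])$, $M_u[\bar u]=D^2\bar u-A(\cdot,u,D\bar u)$. With $F^{ij}=F_{r_{ij}}(M[u])$ and $\mathcal T=\mathcal T(M[u])$, $$Lv=F^{ij}\big[D_{ij}v-A^k_{ij}(\cdot,u,Du)D_kv\big],\qquad \mathcal Lv=Lv-D_{p_k}B(\cdot,u,Du)D_kv .$$ The summation convention is used and $|u|_{1;\Omega}=\sup_\Omega|u|+\sup_\Omega|Du|$.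 Dependence of constants on the listed data includes dependence on the quantitative constants in the hypotheses on that data: e.g. dependence on $\bar u$ includes dependence on $M_u[\bar u]$ and on a constant $\bar\delta>0$ with $M_u[\bar u]-\bar\delta I\in\Gamma$ on $\bar\Omega$ (in case (b), $M_u[\bar u]\ge\bar\delta I$), and on the constants $C_\mu$; in (ii) one may take $\bar\delta$ and a slightly perturbed $\bar u$ such that the subsolution inequality holds strictly.
   Formalization: In (i) uniform constants fail (n=1, F(r)=r, A=0, ū=0), so C' may also depend on a lower bound of F[u], or C on the sign of F[u]; in (ii) either the subsolution inequality is strict with a margin, or ū in η is replaced by a C²-close strict subsolution v independent of u. *)

theory Defs
  imports "HOL-Analysis.Analysis"
begin

section \<open>Symmetric matrices\<close>

definition Sym :: "(real^'n^'n) set" where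
  "Sym = {r. transpose r = r}"

definition Kplus :: "(real^'n^'n) set" where
  "Kplus = {r \<in> Sym. \<forall>\<xi>. \<xi> \<noteq> 0 \<longrightarrow> \<xi> \<bullet> (r *v \<xi>) > 0}"

definition psd :: "real^'n^'n \<Rightarrow> bool" where
  "psd r \<longleftrightarrow> r \<in> Sym \<and> (\<forall>\<xi>. \<xi> \<bullet> (r *v \<xi>) \<ge> 0)"

definition Gamma_set :: "(real^'n^'n) set \<Rightarrow> bool" where
  "Gamma_set \<Gamma> \<longleftrightarrow> openin (top_of_set Sym) \<Gamma> \<and> convex \<Gamma> \<and> Kplus \<subseteq> \<Gamma>
     \<and> (\<forall>r\<in>\<Gamma>. \<forall>s\<in>Kplus. r + s \<in> \<Gamma>)"

section \<open>Partial derivatives\<close>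

definition pd :: "'n \<Rightarrow> (real^'n \<Rightarrow> real) \<Rightarrow> real^'n \<Rightarrow> real" where
  "pd k f x = frechet_derivative f (at x) (axis k 1)"

definition grad :: "(real^'n \<Rightarrow> real) \<Rightarrow> real^'n \<Rightarrow> real^'n" where
  "grad u x = (\<chi> k. pd k u x)"

definition hess :: "(real^'n \<Rightarrow> real) \<Rightarrow> real^'n \<Rightarrow> real^'n^'n" where
  "hess u x = (\<chi> i j. pd i (pd j u) x)"

text \<open>Functions in \<open>C\<^sup>2\<close> of the closed domain: the derivatives up to order two exist in the open
  set \<open>\<Omega>\<close> and extend continuously to its closure.  \<open>gradc\<close> and \<open>hessc\<close> are these
  (unique) extensions; they agree with \<open>grad\<close> and \<open>hess\<close> in \<open>\<Omega>\<close>.\<close>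

definition C2_closure :: "(real^'n) set \<Rightarrow> (real^'n \<Rightarrow> real) \<Rightarrow> bool" where
  "C2_closure \<Omega> u \<longleftrightarrow> continuous_on (closure \<Omega>) u
     \<and> (\<forall>x\<in>\<Omega>. u differentiable (at x) \<and> (\<forall>k. pd k u differentiable (at x)))
     \<and> (\<exists>G. continuous_on (closure \<Omega>) G \<and> (\<forall>x\<in>\<Omega>. G x = grad u x))
     \<and> (\<exists>H. continuous_on (closure \<Omega>) H \<and> (\<forall>x\<in>\<Omega>. H x = hess u x))"

definition gradc :: "(real^'n) set \<Rightarrow> (real^'n \<Rightarrow> real) \<Rightarrow> real^'n \<Rightarrow> real^'n" where
  "gradc \<Omega> u x = Lim (at x within \<Omega>) (grad u)"

definition hessc :: "(real^'n) set \<Rightarrow> (real^'n \<Rightarrow> real) \<Rightarrow> real^'n \<Rightarrow> real^'n^'n" where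
  "hessc \<Omega> u x = Lim (at x within \<Omega>) (hess u)"

definition norm1 :: "(real^'n) set \<Rightarrow> (real^'n \<Rightarrow> real) \<Rightarrow> real" where
  "norm1 \<Omega> u = (SUP x\<in>\<Omega>. \<bar>u x\<bar>) + (SUP x\<in>\<Omega>. norm (grad u x))"

definition C2_near :: "(real^'n) set \<Rightarrow> real \<Rightarrow> (real^'n \<Rightarrow> real) \<Rightarrow> (real^'n \<Rightarrow> real) \<Rightarrow> bool" where
  "C2_near \<Omega> \<epsilon> u v \<longleftrightarrow> (\<forall>x\<in>\<Omega>. \<bar>u x - v x\<bar> \<le> \<epsilon> \<and> norm (grad u x - grad v x) \<le> \<epsilon>
     \<and> norm (hess u x - hess v x) \<le> \<epsilon>)"

section \<open>The operator \<open>F\<close>\<close>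

text \<open>Since \<open>F\<close> is only given on symmetric matrices, \<open>F\<^sub>r\<close> is the symmetric matrix
  representing the derivative through \<open>dF(h) = \<Sum> F\<^sub>r\<^sub>i\<^sub>j h\<^sub>i\<^sub>j\<close>.  Its entry \<open>ij\<close> is
  the derivative in the direction of the symmetrised unit matrix, which has entries \<open>1/2\<close> at
  \<open>ij\<close> and \<open>ji\<close> when \<open>i \<noteq> j\<close>.\<close>

definition Esym :: "'n \<Rightarrow> 'n \<Rightarrow> real^'n^'n" where
  "Esym i j = (\<chi> a b. ((if a = i \<and> b = j then 1 else 0) + (if a = j \<and> b = i then 1 else 0)) / 2)"

definition Fr :: "(real^'n^'n \<Rightarrow> real) \<Rightarrow> real^'n^'n \<Rightarrow> real^'n^'n" where
  "Fr F r = (\<chi> i j. deriv (\<lambda>t. F (r + t *\<^sub>R Esym i j)) 0)"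

definition C1_on :: "(real^'n^'n) set \<Rightarrow> (real^'n^'n \<Rightarrow> real) \<Rightarrow> bool" where
  "C1_on \<Gamma> F \<longleftrightarrow> (\<forall>r\<in>\<Gamma>. (F has_derivative (\<lambda>h. Fr F r \<bullet> h)) (at r within \<Gamma>))
     \<and> continuous_on \<Gamma> (Fr F)"

definition Tr :: "(real^'n^'n \<Rightarrow> real) \<Rightarrow> real^'n^'n \<Rightarrow> real" where
  "Tr F r = trace (Fr F r)"

definition F1 :: "(real^'n^'n) set \<Rightarrow> (real^'n^'n \<Rightarrow> real) \<Rightarrow> bool" where
  "F1 \<Gamma> F \<longleftrightarrow> (\<forall>r\<in>\<Gamma>. Fr F r \<in> Kplus)"

definition F2 :: "(real^'n^'n) set \<Rightarrow> (real^'n^'n \<Rightarrow> real) \<Rightarrow> bool" where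
  "F2 \<Gamma> F \<longleftrightarrow> concave_on \<Gamma> F"

definition Fmu :: "(real^'n^'n) set \<Rightarrow> (real^'n^'n \<Rightarrow> real) \<Rightarrow> bool" where
  "Fmu \<Gamma> F \<longleftrightarrow> (\<forall>\<mu>>0. \<exists>C\<^sub>\<mu>. \<forall>r\<in>\<Gamma>. r \<bullet> Fr F r \<le> F r + \<mu> * Tr F r + C\<^sub>\<mu>)"

section \<open>The functions \<open>A\<close> and \<open>B\<close>\<close>

definition Ap :: "(real^'n \<Rightarrow> real \<Rightarrow> real^'n \<Rightarrow> real^'n^'n) \<Rightarrow> 'n \<Rightarrow> 'n \<Rightarrow> 'n
    \<Rightarrow> real^'n \<Rightarrow> real \<Rightarrow> real^'n \<Rightarrow> real" where
  "Ap A k i j x z p = pd k (\<lambda>q. A x z q $ i $ j) p"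

definition App :: "(real^'n \<Rightarrow> real \<Rightarrow> real^'n \<Rightarrow> real^'n^'n) \<Rightarrow> 'n \<Rightarrow> 'n \<Rightarrow> 'n \<Rightarrow> 'n
    \<Rightarrow> real^'n \<Rightarrow> real \<Rightarrow> real^'n \<Rightarrow> real" where
  "App A k l i j x z p = pd k (\<lambda>q. Ap A l i j x z q) p"

definition A_smooth :: "(real^'n) set \<Rightarrow> (real^'n \<Rightarrow> real \<Rightarrow> real^'n \<Rightarrow> real^'n^'n) \<Rightarrow> bool" where
  "A_smooth \<Omega> A \<longleftrightarrow>
     (\<forall>x\<in>closure \<Omega>. \<forall>z p. A x z p \<in> Sym)
   \<and> continuous_on (closure \<Omega> \<times> UNIV \<times> UNIV) (\<lambda>(x,z,p). A x z p)
   \<and> (\<forall>x\<in>closure \<Omega>. \<forall>z p i j. (\<lambda>q. A x z q $ i $ j) differentiable (at p)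
        \<and> (\<forall>k. (\<lambda>q. Ap A k i j x z q) differentiable (at p)))
   \<and> (\<forall>k l i j. continuous_on (closure \<Omega> \<times> UNIV \<times> UNIV) (\<lambda>(x,z,p). App A k l i j x z p))"

definition A_regular :: "(real^'n) set \<Rightarrow> (real^'n \<Rightarrow> real \<Rightarrow> real^'n \<Rightarrow> real^'n^'n) \<Rightarrow> bool" where
  "A_regular \<Omega> A \<longleftrightarrow> (\<forall>x\<in>closure \<Omega>. \<forall>z p \<xi> \<eta>. \<xi> \<bullet> \<eta> = 0 \<longrightarrow>
     (\<Sum>i\<in>UNIV. \<Sum>j\<in>UNIV. \<Sum>k\<in>UNIV. \<Sum>l\<in>UNIV.
        App A k l i j x z p * \<xi> $ i * \<xi> $ j * \<eta> $ k * \<eta> $ l) \<ge> 0)"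

definition B_smooth :: "(real^'n) set \<Rightarrow> (real^'n \<Rightarrow> real \<Rightarrow> real^'n \<Rightarrow> real) \<Rightarrow> bool" where
  "B_smooth \<Omega> B \<longleftrightarrow>
     continuous_on (closure \<Omega> \<times> UNIV \<times> UNIV) (\<lambda>(x,z,p). B x z p)
   \<and> (\<forall>x\<in>closure \<Omega>. \<forall>z p. B x z differentiable (at p))
   \<and> (\<forall>k. continuous_on (closure \<Omega> \<times> UNIV \<times> UNIV) (\<lambda>(x,z,p). pd k (B x z) p))"

definition B_convex :: "(real^'n) set \<Rightarrow> (real^'n \<Rightarrow> real \<Rightarrow> real^'n \<Rightarrow> real) \<Rightarrow> bool" where
  "B_convex \<Omega> B \<longleftrightarrow> (\<forall>x\<in>closure \<Omega>. \<forall>z. convex_on UNIV (B x z))"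

section \<open>The differential operators\<close>

text \<open>\<open>Mop \<Omega> A u v\<close> is \<open>M\<^sub>u[v]\<close>; in particular \<open>Mop \<Omega> A u u\<close> is \<open>M[u]\<close>.\<close>

definition Mop :: "(real^'n) set \<Rightarrow> (real^'n \<Rightarrow> real \<Rightarrow> real^'n \<Rightarrow> real^'n^'n)
    \<Rightarrow> (real^'n \<Rightarrow> real) \<Rightarrow> (real^'n \<Rightarrow> real) \<Rightarrow> real^'n \<Rightarrow> real^'n^'n" where
  "Mop \<Omega> A u v x = hessc \<Omega> v x - A x (u x) (gradc \<Omega> v x)"

definition Lop :: "(real^'n) set \<Rightarrow> (real^'n^'n \<Rightarrow> real)
    \<Rightarrow> (real^'n \<Rightarrow> real \<Rightarrow> real^'n \<Rightarrow> real^'n^'n)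
    \<Rightarrow> (real^'n \<Rightarrow> real) \<Rightarrow> (real^'n \<Rightarrow> real) \<Rightarrow> real^'n \<Rightarrow> real" where
  "Lop \<Omega> F A u v x = (\<Sum>i\<in>UNIV. \<Sum>j\<in>UNIV. Fr F (Mop \<Omega> A u u x) $ i $ j *
     (pd i (pd j v) x - (\<Sum>k\<in>UNIV. Ap A k i j x (u x) (grad u x) * pd k v x)))"

definition LBop :: "(real^'n) set \<Rightarrow> (real^'n^'n \<Rightarrow> real)
    \<Rightarrow> (real^'n \<Rightarrow> real \<Rightarrow> real^'n \<Rightarrow> real^'n^'n) \<Rightarrow> (real^'n \<Rightarrow> real \<Rightarrow> real^'n \<Rightarrow> real)
    \<Rightarrow> (real^'n \<Rightarrow> real) \<Rightarrow> (real^'n \<Rightarrow> real) \<Rightarrow> real^'n \<Rightarrow> real" where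
  "LBop \<Omega> F A B u v x = Lop \<Omega> F A u v x
     - (\<Sum>k\<in>UNIV. pd k (B x (u x)) (grad u x) * pd k v x)"

section \<open>Classes of functions sharing the quantitative data\<close>

text \<open>The constants of the estimates may depend on \<open>u\<close> only through a bound \<open>R\<close> for its
  \<open>C\<^sup>1\<close> norm and the constant \<open>d > 0\<close> in the admissibility of \<open>w\<close> with respect to \<open>u\<close>, so
  they have to be uniform over each of the following classes.  Every \<open>u\<close> satisfying the
  qualitative conditions belongs to such a class for some \<open>R\<close> and \<open>d\<close>, because the closure of
  \<open>\<Omega>\<close> is compact.\<close>

definition admissible_class :: "(real^'n) set \<Rightarrow> (real^'n^'n) set
    \<Rightarrow> (real^'n \<Rightarrow> real \<Rightarrow> real^'n \<Rightarrow> real^'n^'n)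
    \<Rightarrow> (real^'n \<Rightarrow> real) \<Rightarrow> real \<Rightarrow> real \<Rightarrow> (real^'n \<Rightarrow> real) set" where
  "admissible_class \<Omega> \<Gamma> A w R d = {u. C2_closure \<Omega> u \<and> norm1 \<Omega> u \<le> R
     \<and> (\<forall>x\<in>closure \<Omega>. Mop \<Omega> A u u x \<in> \<Gamma>)
     \<and> (\<forall>x\<in>closure \<Omega>. Mop \<Omega> A u w x \<in> \<Gamma> \<and> Mop \<Omega> A u w x - mat d \<in> \<Gamma>)}"

definition positive_class :: "(real^'n) set \<Rightarrow> (real^'n^'n) set
    \<Rightarrow> (real^'n \<Rightarrow> real \<Rightarrow> real^'n \<Rightarrow> real^'n^'n)
    \<Rightarrow> (real^'n \<Rightarrow> real) \<Rightarrow> real \<Rightarrow> real \<Rightarrow> (real^'n \<Rightarrow> real) set" where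
  "positive_class \<Omega> \<Gamma> A w R d = {u. C2_closure \<Omega> u \<and> norm1 \<Omega> u \<le> R
     \<and> (\<forall>x\<in>closure \<Omega>. Mop \<Omega> A u u x \<in> \<Gamma>)
     \<and> (\<forall>x\<in>closure \<Omega>. Mop \<Omega> A u w x \<in> Kplus \<and> psd (Mop \<Omega> A u w x - mat d))}"

definition supersolution :: "(real^'n) set \<Rightarrow> (real^'n^'n \<Rightarrow> real)
    \<Rightarrow> (real^'n \<Rightarrow> real \<Rightarrow> real^'n \<Rightarrow> real^'n^'n) \<Rightarrow> (real^'n \<Rightarrow> real \<Rightarrow> real^'n \<Rightarrow> real)
    \<Rightarrow> (real^'n \<Rightarrow> real) \<Rightarrow> bool" where
  "supersolution \<Omega> F A B u \<longleftrightarrow> (\<forall>x\<in>\<Omega>. F (Mop \<Omega> A u u x) \<le> B x (u x) (grad u x))"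

text \<open>The subsolution condition on \<open>w\<close> with respect to \<open>u\<close>, with margin \<open>\<theta>\<close>; it is the plain
  condition for \<open>\<theta> = 0\<close> and the strict one for \<open>\<theta> > 0\<close>.\<close>

definition subsolution :: "(real^'n) set \<Rightarrow> (real^'n^'n \<Rightarrow> real)
    \<Rightarrow> (real^'n \<Rightarrow> real \<Rightarrow> real^'n \<Rightarrow> real^'n^'n) \<Rightarrow> (real^'n \<Rightarrow> real \<Rightarrow> real^'n \<Rightarrow> real)
    \<Rightarrow> real \<Rightarrow> (real^'n \<Rightarrow> real) \<Rightarrow> (real^'n \<Rightarrow> real) \<Rightarrow> bool" where
  "subsolution \<Omega> F A B \<theta> u w \<longleftrightarrow>
     (\<forall>x\<in>\<Omega>. F (Mop \<Omega> A u w x) \<ge> B x (u x) (grad w x) + \<theta>)"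

text \<open>Two points on the estimates themselves.

  With \<open>\<eta> = exp (K (w - u))\<close>, the proof of part (i) gives \<open>L \<eta> \<ge> K \<eta> (\<delta>' \<T> - \<F>[u] - C'')\<close>, where
  \<open>K \<eta>\<close> lies between two positive constants.  So the factor of \<open>\<F>[u]\<close> is one constant \<open>C\<close> where
  \<open>\<F>[u] \<ge> 0\<close> and another one \<open>C\<^sub>0\<close> where \<open>\<F>[u] < 0\<close>.  If \<open>\<F>[u] \<ge> m\<close>, then \<open>C\<close> serves for both
  signs, with \<open>C'\<close> depending also on \<open>m\<close>; such an \<open>m\<close> exists for every \<open>u\<close>, and it is part of
  the data \<open>F\<close> when \<open>F\<close> is bounded below.  For \<open>F\<close> unbounded below, such as
  \<open>F(r) = trace r\<close> on all symmetric matrices, no single pair \<open>C\<close>, \<open>C'\<close> is uniform in \<open>u\<close>.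

  In part (ii) the case of a solution \<open>u = w\<close>, where \<open>\<eta> = 1\<close>, shows that a strict subsolution inequality is
  needed.  If the given inequality is not strict, \<open>w\<close> has first to be replaced by
  a perturbation \<open>v\<close>, arbitrarily small in \<open>C\<^sup>2\<close> and independent of \<open>u\<close>.\<close>

end

theory Submission
  imports Defs
begin

text \<open>Write \<open>p = Du\<close>, \<open>q = Dw\<close>, \<open>e = q - p\<close>, \<open>a = F\<^sub>r(M[u])\<close> and \<open>\<eta> = exp (K (w - u))\<close>.  Then
  \<open>L \<eta> / (K \<eta>)\<close> is the sum of \<open>a \<cdot> (M\<^sub>u[w] - M[u])\<close>, of the Taylor remainder
  \<open>a \<cdot> (A(q) - A(p) - A\<^sub>p(p) e)\<close> and of \<open>K a(e, e)\<close>.  By regularity the remainder is at least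
  \<open>- \<epsilon> \<T> - C\<^sub>\<epsilon> a(e, e)\<close>, so that the last term absorbs it once \<open>K \<ge> C\<^sub>\<epsilon>\<close>.  In the first term the margin
  in \<open>M\<^sub>u[w] - mat d\<close> yields a positive multiple of \<open>\<T>\<close>: if \<open>F\<close> is concave, \<open>M[u]\<close> is compared with
  \<open>M\<^sub>u[w] - mat s\<close> for a small \<open>s > 0\<close>, and otherwise \<open>a \<cdot> M\<^sub>u[w] \<ge> d \<T>\<close> is combined with the bound for
  \<open>r \<cdot> F\<^sub>r(r)\<close>.  In part (ii) convexity of \<open>B\<close> turns \<open>- B\<^sub>p(p) \<cdot> e\<close> into \<open>B(p) - B(q)\<close>, which the
  differential inequalities for \<open>u\<close> and \<open>w\<close> bound from below by \<open>F(M[u]) - F(M\<^sub>u[w]) + d\<close>.\<close>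

section \<open>Symmetric matrices\<close>

text \<open>No second derivative of \<open>u\<close> is controlled, so \<open>M[u]\<close> may leave
  every compact part of \<Gamma>, and \<open>a\<close> has no bounds independent of
  \<open>u\<close>. Errors in the first order terms can therefore be absorbed only by
  \<open>\<epsilon> \<T>\<close> or by \<open>a(e, e)\<close>, while compactness is reserved for
  \<open>M_u[w]\<close>, where \<open>u\<close> enters only through its value at the point. Written
  with \<open>outer e\<close> and \<open>mat s\<close>, the quantities \<open>a(e, e)\<close> and
  \<open>s \<T>\<close> are inner products with \<open>a\<close>, so that such bounds reduce to
  \<open>0 \<le> a \<bullet> Q\<close> for a single \<open>Q\<close> with nonnegative form. The
  remainder can be absorbed because the quadratic Taylor term is of size
  \<open>(norm e)\<^sup>2\<close> itself: what spoils its sign is a mixed term with a factor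
  \<open>e \<bullet> \<xi>\<close>, whose coefficient stays bounded as \<open>e\<close> tends to
  zero. The constants depend on each other in one direction only: the margin \<open>s\<close> is
  fixed before \<open>\<epsilon> = s / 2\<close>, this determines \<open>K\<close>, and the bounds
  for \<open>K \<eta>\<close> come last.\<close>

definition outer :: "real^'n \<Rightarrow> real^'n^'n" where
  "outer v = (\<chi> i j. v $ i * v $ j)"

lemma inner_matrix_eq_sum: "(a :: real^'n^'m) \<bullet> b = (\<Sum>i\<in>UNIV. \<Sum>j\<in>UNIV. a $ i $ j * b $ i $ j)"
  by (simp add: inner_vec_def)

lemma matrix_form_eq_sum: "\<xi> \<bullet> ((a :: real^'n^'n) *v \<zeta>) = (\<Sum>i\<in>UNIV. \<Sum>j\<in>UNIV. a $ i $ j * \<xi> $ i * \<zeta> $ j)"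
  by (simp add: inner_vec_def matrix_vector_mult_def sum_distrib_left mult_ac)

lemma inner_outer: "a \<bullet> outer v = v \<bullet> (a *v v)"
  by (simp add: inner_matrix_eq_sum matrix_form_eq_sum outer_def mult_ac)

lemma outer_mult_vec: "outer v *v \<xi> = (v \<bullet> \<xi>) *\<^sub>R v"
  by (simp add: vec_eq_iff outer_def matrix_vector_mult_def inner_vec_def sum_distrib_left sum_distrib_right mult_ac)

lemma inner_mat: "(a :: real^'n^'n) \<bullet> mat s = s * trace a"
proof -
  have "a $ i \<bullet> mat s $ i = s * a $ i $ i" for i
    by (simp add: inner_vec_def mat_def if_distrib cong: if_cong)
  then show ?thesis
    by (simp add: inner_vec_def[of a] trace_def sum_distrib_left)
qed

lemma mat_mult_vec: "mat s *v (\<xi> :: real^'n) = s *\<^sub>R \<xi>"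
  by (simp add: vec_eq_iff matrix_vector_mult_def mat_def if_distrib[of "\<lambda>c. c * _"] cong: if_cong)

lemma mat_add: "mat (s + t) = (mat s + mat t :: real^'n^'n)"
  by (simp add: vec_eq_iff mat_def)

lemma norm_outer: "norm (outer v) = (norm v)\<^sup>2"
proof -
  have "norm (outer v) ^ 2 = ((norm v)\<^sup>2)\<^sup>2"
    unfolding power2_norm_eq_inner[of "outer v"] inner_outer outer_mult_vec
    by (simp add: dot_square_norm power2_eq_square)
  then show ?thesis
    by (metis norm_ge_zero power2_eq_iff_nonneg zero_le_power2)
qed

text \<open>The norm of a matrix is here the Euclidean norm of its entries, so Cauchy-Schwarz in
  each row suffices.\<close>

lemma abs_form_le: "\<bar>\<xi> \<bullet> ((a :: real^'n^'n) *v \<zeta>)\<bar> \<le> norm a * norm \<xi> * norm \<zeta>"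
proof -
  have "(norm (a *v \<zeta>))\<^sup>2 = (\<Sum>i\<in>UNIV. (a $ i \<bullet> \<zeta>)\<^sup>2)"
    unfolding power2_norm_eq_inner inner_vec_def[of "a *v \<zeta>"]
    by (simp add: matrix_vector_mul_component power2_eq_square)
  also have "\<dots> \<le> (\<Sum>i\<in>UNIV. (norm (a $ i))\<^sup>2 * (norm \<zeta>)\<^sup>2)"
    by (intro sum_mono) (use Cauchy_Schwarz_ineq in \<open>auto simp: power2_norm_eq_inner\<close>)
  also have "\<dots> = (norm a * norm \<zeta>)\<^sup>2"
    by (simp add: power2_norm_eq_inner inner_vec_def[of a] sum_distrib_right power_mult_distrib)
  finally have "norm (a *v \<zeta>) \<le> norm a * norm \<zeta>"
    by (meson norm_ge_zero mult_nonneg_nonneg power2_le_imp_le)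
  then have "norm \<xi> * norm (a *v \<zeta>) \<le> norm \<xi> * (norm a * norm \<zeta>)"
    by (simp add: mult_left_mono)
  with Cauchy_Schwarz_ineq2[of \<xi> "a *v \<zeta>"] show ?thesis
    by (simp add: mult_ac)
qed

lemma Sym_iff: "a \<in> Sym \<longleftrightarrow> (\<forall>i j. a $ i $ j = a $ j $ i)"
  unfolding Sym_def transpose_def by (auto simp: vec_eq_iff)

lemma Sym_form: "a \<in> Sym \<Longrightarrow> \<xi> \<bullet> (a *v \<zeta>) = \<zeta> \<bullet> (a *v \<xi>)"
  unfolding Sym_def
  by (metis (mono_tags, lifting) dot_lmul_matrix inner_commute mem_Collect_eq transpose_matrix_vector)

lemma Sym_add: "a \<in> Sym \<Longrightarrow> b \<in> Sym \<Longrightarrow> a + b \<in> Sym"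
  and Sym_diff: "a \<in> Sym \<Longrightarrow> b \<in> Sym \<Longrightarrow> a - b \<in> Sym"
  and Sym_scaleR: "a \<in> Sym \<Longrightarrow> s *\<^sub>R a \<in> Sym"
  and Sym_outer: "outer v \<in> Sym"
  and Sym_mat: "mat s \<in> Sym"
  by (auto simp: Sym_iff outer_def mat_def)

lemma closed_Sym: "closed (Sym :: (real^'n^'n) set)"
proof -
  have "closed {a :: real^'n^'n. \<forall>i j. a $ i $ j = a $ j $ i}"
    by (intro closed_Collect_all closed_Collect_eq continuous_intros)
  then show ?thesis
    by (simp add: Sym_iff[abs_def, symmetric] flip: Sym_iff)
qed

lemma Kplus_imp_psd: "a \<in> Kplus \<Longrightarrow> psd a"
  unfolding Kplus_def psd_def by (auto simp: less_imp_le) (metis inner_zero_left less_eq_real_def)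

text \<open>The right-hand side is the form at \<open>\<xi> + t *\<^sub>R axis i 1\<close>, a
  quadratic polynomial in \<open>t\<close>. Special choices of \<xi> and \<open>t\<close> give the
  sign of the diagonal, the vanishing of a row with zero diagonal entry, and the sign of the form
  after one elimination step.\<close>

lemma psd_form_add_axis:
  fixes a :: "real^'n^'n"
  assumes "psd a"
  shows "0 \<le> \<xi> \<bullet> (a *v \<xi>) + 2 * t * (a $ i \<bullet> \<xi>) + t\<^sup>2 * a $ i $ i"
proof -
  let ?e = "axis i 1 :: real^'n"
  have e: "?e \<bullet> (a *v \<zeta>) = a $ i \<bullet> \<zeta>" for \<zeta>
    by (simp add: inner_axis' matrix_vector_mul_component)
  have s: "\<xi> \<bullet> (a *v ?e) = a $ i \<bullet> \<xi>"
    using Sym_form[of a \<xi> ?e] assms e by (simp add: psd_def)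
  have "0 \<le> (\<xi> + t *\<^sub>R ?e) \<bullet> (a *v (\<xi> + t *\<^sub>R ?e))"
    using assms by (simp add: psd_def)
  also have "\<dots> = \<xi> \<bullet> (a *v \<xi>) + 2 * t * (a $ i \<bullet> \<xi>) + t\<^sup>2 * (a $ i \<bullet> ?e)"
    by (simp add: matrix_vector_right_distrib matrix_vector_mult_scaleR inner_add_left inner_add_right e s power2_eq_square distrib_left)
  finally show ?thesis by (simp add: inner_axis)
qed

text \<open>If the diagonal entry vanishes, the polynomial above is affine in \<open>t\<close>,
  hence its slope must vanish. With the row itself as \<xi> the slope is twice the squared norm of
  the row.\<close>

lemma psd_diag_zero:
  assumes "psd a" "a $ i $ i = 0"
  shows "a $ i = 0"
proof -
  let ?v = "a $ i"
  \<comment> \<open>This value of \<open>t\<close> makes the affine function equal to -1.\<close>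
  define t where "t = - (?v \<bullet> (a *v ?v) + 1) / (2 * (?v \<bullet> ?v))"
  have "?v = 0"
  proof (rule ccontr)
    assume "?v \<noteq> 0"
    then have "?v \<bullet> ?v \<noteq> 0" by simp
    then have "2 * t * (?v \<bullet> ?v) = - (?v \<bullet> (a *v ?v) + 1)" unfolding t_def by (simp add: divide_simps)
    with psd_form_add_axis[OF assms(1), of ?v t i] assms(2) show False by simp
  qed
  then show ?thesis .
qed

text \<open>Subtracting \<open>outer (a $ i) / a\<^sub>i\<^sub>i\<close> clears row \<open>i\<close> and keeps the matrix nonnegative, which
  replaces a spectral decomposition of \<open>a\<close>.\<close>

lemma psd_inner_nonneg:
  fixes a Q :: "real^'n^'n"
  assumes "psd a" and Q: "\<And>\<xi>. 0 \<le> \<xi> \<bullet> (Q *v \<xi>)"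
  shows "0 \<le> a \<bullet> Q"
  using assms(1)
proof (induction "card {i. a $ i \<noteq> 0}" arbitrary: a rule: less_induct)
  case less
  show ?case
  proof (cases "a = 0")
    case False
    then obtain i where i: "a $ i \<noteq> 0" by (metis vec_eq_iff zero_index)
    let ?c = "a $ i $ i"
    have "?c \<noteq> 0" using psd_diag_zero[OF less.prems] i by blast
    moreover have "0 \<le> ?c"
      using psd_form_add_axis[OF less.prems, of 0 1 i] by simp
    ultimately have c: "0 < ?c" by simp
    define b where "b = a - (1 / ?c) *\<^sub>R outer (a $ i)"
    have sym: "a \<in> Sym" using less.prems by (simp add: psd_def)
    have bi: "b $ i = 0"
      using c by (simp add: b_def vec_eq_iff outer_def)
    \<comment> \<open>Symmetry is what keeps cleared rows clear: if row \<open>k\<close> vanishes,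
      so does the entry \<open>a $ i $ k\<close>, and row \<open>k\<close> of the subtracted matrix
      is a multiple of this entry.\<close>
    have bz: "b $ k = 0" if "a $ k = 0" for k
    proof -
      have "a $ i $ k = 0" using sym that by (metis Sym_iff zero_index)
      with that show ?thesis by (simp add: b_def vec_eq_iff outer_def)
    qed
    have "{k. b $ k \<noteq> 0} \<subset> {k. a $ k \<noteq> 0}" using bi bz i by auto
    then have card: "card {k. b $ k \<noteq> 0} < card {k. a $ k \<noteq> 0}"
      by (simp add: psubset_card_mono)
    have "0 \<le> \<xi> \<bullet> (b *v \<xi>)" for \<xi>
    proof -
      have "\<xi> \<bullet> (b *v \<xi>) = \<xi> \<bullet> (a *v \<xi>) - (a $ i \<bullet> \<xi>)\<^sup>2 / ?c"
        by (simp add: b_def matrix_vector_mult_diff_rdistrib scaleR_matrix_vector_assoc[symmetric]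
            inner_diff_right outer_mult_vec power2_eq_square inner_commute)
      \<comment> \<open>The form of \<open>b\<close> is the minimum over \<open>t\<close> of the
        quadratic polynomial, attained at
        \<open>t = - (a $ i \<bullet> \<xi>) / a $ i $ i\<close>.\<close>
      also have "\<dots> = \<xi> \<bullet> (a *v \<xi>) + 2 * (- (a $ i \<bullet> \<xi>) / ?c) * (a $ i \<bullet> \<xi>)
          + (- (a $ i \<bullet> \<xi>) / ?c)\<^sup>2 * ?c"
        using c by (simp add: field_simps power2_eq_square)
      finally show ?thesis using psd_form_add_axis[OF less.prems, of \<xi> _ i] by metis
    qed
    then have "psd b"
      using sym by (simp add: psd_def b_def Sym_diff Sym_scaleR Sym_outer)
    from less.hyps[OF card this] have "0 \<le> b \<bullet> Q" .
    moreover have "b \<bullet> Q = a \<bullet> Q - (a $ i \<bullet> (Q *v a $ i)) / ?c"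
      by (simp add: b_def inner_diff_left inner_commute[of "outer _"] inner_outer)
    moreover have "0 \<le> (a $ i \<bullet> (Q *v a $ i)) / ?c"
      using Q c by simp
    ultimately show ?thesis by linarith
  qed simp
qed

lemma trace_nonneg: "psd a \<Longrightarrow> 0 \<le> trace a"
  using psd_inner_nonneg[of a "mat 1"] by (simp add: inner_mat mat_mult_vec)

lemma Kplus_diag_pos:
  assumes "a \<in> Kplus" shows "0 < a $ k $ k"
proof -
  have "0 < axis k 1 \<bullet> (a *v axis k (1::real))"
    using assms unfolding Kplus_def by auto
  then show ?thesis
    by (simp add: inner_axis' inner_axis matrix_vector_mul_component)
qed

text \<open>This quantifies that \<open>mat s\<close> is interior to the positive cone relative to
  \<open>Sym\<close>. Together with the stability of \<Gamma> under positive matrices, it shows that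
  a shift by \<open>mat s\<close> makes room for symmetric perturbations smaller than
  \<open>s\<close>.\<close>

lemma mat_add_in_Kplus:
  assumes "h \<in> Sym" "norm h < s"
  shows "mat s + h \<in> Kplus"
proof -
  have "0 < \<xi> \<bullet> ((mat s + h) *v \<xi>)" if "\<xi> \<noteq> 0" for \<xi>
  proof -
    have "norm h * (norm \<xi> * norm \<xi>) < s * (norm \<xi> * norm \<xi>)"
      using assms(2) that by simp
    then show ?thesis
      using abs_form_le[of \<xi> h \<xi>]
      by (simp add: matrix_vector_mult_add_rdistrib mat_mult_vec inner_add_right dot_square_norm power2_eq_square mult_ac)
  qed
  then show ?thesis
    using assms(1) by (auto simp: Kplus_def Sym_add Sym_mat)
qed

text \<open>Split \<xi> into a part \<zeta> orthogonal to \<open>e\<close> and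
  \<open>\<kappa> *\<^sub>R e\<close>. The form is nonnegative at \<zeta>, and all other terms carry
  the factor \<kappa>. The denominator \<open>(norm e)\<^sup>2\<close> of \<kappa> cancels against
  the bound for \<open>norm Q\<close>, so nothing degenerates for small \<open>e\<close>; Young's
  inequality with weight \<epsilon> then separates \<open>norm \<xi>\<close> from
  \<open>e \<bullet> \<xi>\<close>.\<close>

lemma form_lower_bound:
  fixes Q :: "real^'n^'n"
  assumes Qc: "norm Q \<le> c * (norm e)\<^sup>2" and c: "0 \<le> c" and \<epsilon>: "0 < \<epsilon>"
    and pos: "\<And>\<xi>. \<xi> \<bullet> e = 0 \<Longrightarrow> 0 \<le> \<xi> \<bullet> (Q *v \<xi>)"
  shows "- \<epsilon> * (norm \<xi>)\<^sup>2 - (c * norm e)\<^sup>2 / \<epsilon> * (e \<bullet> \<xi>)\<^sup>2 \<le> \<xi> \<bullet> (Q *v \<xi>)"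
proof (cases "e = 0")
  case True
  with Qc have "Q = 0" by simp
  with True \<epsilon> show ?thesis by simp
next
  case False
  define \<kappa> where "\<kappa> = (\<xi> \<bullet> e) / (norm e)\<^sup>2"
  define \<zeta> where "\<zeta> = \<xi> - \<kappa> *\<^sub>R e"
  have orth: "\<zeta> \<bullet> e = 0"
    using False by (simp add: \<zeta>_def \<kappa>_def inner_diff_left dot_square_norm)
  have "(norm \<xi>)\<^sup>2 = (norm \<zeta>)\<^sup>2 + (norm (\<kappa> *\<^sub>R e))\<^sup>2"
    using norm_add_Pythagorean[of \<zeta> "\<kappa> *\<^sub>R e"] orth by (simp add: \<zeta>_def orthogonal_def)
  then have "(norm \<zeta>)\<^sup>2 \<le> (norm \<xi>)\<^sup>2" by simp
  then have n\<zeta>: "norm \<zeta> \<le> norm \<xi>" by (simp add: power2_le_iff_abs_le)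
  have \<xi>: "\<xi> = \<zeta> + \<kappa> *\<^sub>R e" by (simp add: \<zeta>_def)
  \<comment> \<open>Only one factor is split at a time. Keeping \<xi> on the left in the product
    with \<open>Q *v e\<close> avoids a term quadratic in \<kappa>.\<close>
  have "\<xi> \<bullet> (Q *v \<xi>) = \<xi> \<bullet> (Q *v \<zeta>) + \<kappa> * (\<xi> \<bullet> (Q *v e))"
    by (subst(2) \<xi>) (simp add: matrix_vector_right_distrib matrix_vector_mult_scaleR inner_add_right)
  also have "\<xi> \<bullet> (Q *v \<zeta>) = \<zeta> \<bullet> (Q *v \<zeta>) + \<kappa> * (e \<bullet> (Q *v \<zeta>))"
    by (subst \<xi>) (simp add: inner_add_left)
  finally have "\<xi> \<bullet> (Q *v \<xi>) \<ge> \<kappa> * (e \<bullet> (Q *v \<zeta>)) + \<kappa> * (\<xi> \<bullet> (Q *v e))"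
    using pos[OF orth] by simp
  moreover have "\<bar>\<kappa> * (e \<bullet> (Q *v \<zeta>))\<bar> \<le> c * norm e * norm \<xi> * \<bar>e \<bullet> \<xi>\<bar>"
    and "\<bar>\<kappa> * (\<xi> \<bullet> (Q *v e))\<bar> \<le> c * norm e * norm \<xi> * \<bar>e \<bullet> \<xi>\<bar>"
  proof -
    have *: "\<bar>\<kappa> * y\<bar> \<le> c * norm e * norm \<xi> * \<bar>e \<bullet> \<xi>\<bar>" if "\<bar>y\<bar> \<le> norm Q * norm e * norm \<xi>" for y
    proof -
      have "\<bar>\<kappa> * y\<bar> \<le> \<bar>\<kappa>\<bar> * (c * (norm e)\<^sup>2 * norm e * norm \<xi>)"
        unfolding abs_mult using Qc
        by (intro mult_left_mono order_trans[OF that] mult_right_mono) auto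
      also have "\<dots> = c * norm e * norm \<xi> * \<bar>e \<bullet> \<xi>\<bar>"
        using False by (simp add: \<kappa>_def abs_divide inner_commute)
      finally show ?thesis .
    qed
    have "norm Q * norm e * norm \<zeta> \<le> norm Q * norm e * norm \<xi>"
      using n\<zeta> by (simp add: mult_left_mono)
    with abs_form_le[of e Q \<zeta>] show "\<bar>\<kappa> * (e \<bullet> (Q *v \<zeta>))\<bar> \<le> c * norm e * norm \<xi> * \<bar>e \<bullet> \<xi>\<bar>"
      by (intro *) linarith
    show "\<bar>\<kappa> * (\<xi> \<bullet> (Q *v e))\<bar> \<le> c * norm e * norm \<xi> * \<bar>e \<bullet> \<xi>\<bar>"
      using abs_form_le[of \<xi> Q e] by (intro *) (simp add: mult_ac)
  qed
  ultimately have "\<xi> \<bullet> (Q *v \<xi>) \<ge> - 2 * (c * norm e * norm \<xi> * \<bar>e \<bullet> \<xi>\<bar>)"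
    by linarith
  moreover have "2 * (c * norm e * norm \<xi> * \<bar>e \<bullet> \<xi>\<bar>) \<le> \<epsilon> * (norm \<xi>)\<^sup>2 + (c * norm e)\<^sup>2 / \<epsilon> * (e \<bullet> \<xi>)\<^sup>2"
  proof -
    have "0 \<le> (\<epsilon> * norm \<xi> - c * norm e * \<bar>e \<bullet> \<xi>\<bar>)\<^sup>2 / \<epsilon>" using \<epsilon> by simp
    also have "\<dots> = \<epsilon> * (norm \<xi>)\<^sup>2 + (c * norm e)\<^sup>2 / \<epsilon> * (e \<bullet> \<xi>)\<^sup>2 - 2 * (c * norm e * norm \<xi> * \<bar>e \<bullet> \<xi>\<bar>)"
      using \<epsilon> by (simp add: field_simps power2_eq_square)
    finally show ?thesis by simp
  qed
  ultimately show ?thesis by simp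
qed

text \<open>The bound for vectors says that \<open>Q + mat \<epsilon> + C *\<^sub>R outer e\<close>
  has a nonnegative form. Pairing with the nonnegative matrix \<open>a\<close> turns the two
  correction terms into the trace and \<open>a(e, e)\<close>.\<close>

lemma inner_psd_lower_bound:
  fixes a Q :: "real^'n^'n"
  assumes "psd a" "norm Q \<le> c * (norm e)\<^sup>2" "0 \<le> c" "0 < \<epsilon>"
    and "\<And>\<xi>. \<xi> \<bullet> e = 0 \<Longrightarrow> 0 \<le> \<xi> \<bullet> (Q *v \<xi>)"
  shows "- \<epsilon> * trace a - (c * norm e)\<^sup>2 / \<epsilon> * (a \<bullet> outer e) \<le> a \<bullet> Q"
proof -
  define C where "C = (c * norm e)\<^sup>2 / \<epsilon>"
  have "0 \<le> \<xi> \<bullet> ((Q + mat \<epsilon> + C *\<^sub>R outer e) *v \<xi>)" for \<xi>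
    using form_lower_bound[OF assms(2-5), of \<xi>]
    by (simp add: C_def matrix_vector_mult_add_rdistrib scaleR_matrix_vector_assoc[symmetric] mat_mult_vec
        outer_mult_vec inner_add_right power2_eq_square dot_square_norm inner_commute)
  from psd_inner_nonneg[OF assms(1) this] show ?thesis
    by (simp add: C_def inner_add_right inner_mat)
qed

section \<open>Derivatives\<close>

lemma pd_eq: "(f has_derivative f') (at x) \<Longrightarrow> pd k f x = f' (axis k 1)"
  unfolding pd_def using frechet_derivative_at by metis

lemma has_derivative_pd:
  assumes "f differentiable (at x)"
  shows "(f has_derivative (\<lambda>h. \<Sum>k\<in>UNIV. pd k f x * h $ k)) (at x)"
proof -
  obtain f' where f': "(f has_derivative f') (at x)"
    using assms by (auto simp: differentiable_def)
  then interpret bounded_linear f' by (rule has_derivative_bounded_linear)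
  have "f' h = (\<Sum>k\<in>UNIV. pd k f x * h $ k)" for h
  proof -
    have "h = (\<Sum>k\<in>UNIV. h $ k *\<^sub>R axis k 1)"
      by (simp add: vec_eq_iff axis_def if_distrib cong: if_cong)
    then have "f' h = f' (\<Sum>k\<in>UNIV. h $ k *\<^sub>R axis k 1)"
      by (rule arg_cong)
    then show ?thesis by (simp add: sum scaleR pd_eq[OF f'] mult.commute)
  qed
  then have "f' = (\<lambda>h. \<Sum>k\<in>UNIV. pd k f x * h $ k)" by (rule ext)
  with f' show ?thesis by simp
qed

lemma pd_line:
  assumes "f differentiable (at (p + s *\<^sub>R e))"
  shows "((\<lambda>s. f (p + s *\<^sub>R e)) has_real_derivative (\<Sum>k\<in>UNIV. pd k f (p + s *\<^sub>R e) * e $ k)) (at s)"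
proof -
  have "((\<lambda>s. p + s *\<^sub>R e) has_derivative (\<lambda>t. t *\<^sub>R e)) (at s)"
    by (auto intro!: derivative_eq_intros)
  from has_derivative_compose[OF this has_derivative_pd[OF assms]]
  show ?thesis
    unfolding has_field_derivative_def
    by (rule has_derivative_eq_rhs) (auto simp: sum_distrib_left sum_distrib_right mult_ac fun_eq_iff)
qed

text \<open>Formulas for first derivatives hold only inside \<Omega>. Second derivatives are
  computed by replacing a first derivative by its formula near the point, which this locality
  permits.\<close>

lemma pd_transform_within_open:
  assumes "open S" "x \<in> S" "f differentiable (at x)" "\<And>y. y \<in> S \<Longrightarrow> f y = g y"
  shows "pd k g x = pd k f x" "g differentiable (at x)"
proof -
  have g: "(g has_derivative (\<lambda>h. \<Sum>k\<in>UNIV. pd k f x * h $ k)) (at x)"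
    using has_derivative_transform_within_open[OF has_derivative_pd[OF assms(3)] assms(1,2)] assms(4) by blast
  show "pd k g x = pd k f x"
    by (rule trans[OF pd_eq[OF g] pd_eq[OF has_derivative_pd[OF assms(3)], symmetric]])
  show "g differentiable (at x)" using g unfolding differentiable_def by blast
qed

text \<open>Along the segment from \<open>x\<close> to \<open>y\<close> the difference quotients are
  at most \<open>f y - f x\<close>, and they converge to \<open>f' (y - x)\<close>. The derivative
  is taken within \<open>S\<close> because \<Gamma> is open only relative to the symmetric
  matrices.\<close>

lemma convex_on_above_tangent:
  fixes f :: "'a::real_normed_vector \<Rightarrow> real"
  assumes f: "convex_on S f" and f': "(f has_derivative f') (at x within S)" and "x \<in> S" "y \<in> S"
  shows "f x + f' (y - x) \<le> f y"
proof -
  let ?h = "\<lambda>t. x + t *\<^sub>R (y - x)"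
  have h: "?h t = (1 - t) *\<^sub>R x + t *\<^sub>R y" for t by (simp add: algebra_simps)
  have sub: "?h ` {0..1} \<subseteq> S"
    using convex_on_imp_convex[OF f] assms(3,4) unfolding h by (auto simp: convex_alt)
  have "(?h has_derivative (\<lambda>t. t *\<^sub>R (y - x))) (at 0 within {0..1})"
    by (auto intro!: derivative_eq_intros)
  moreover have "(f has_derivative f') (at (?h 0) within ?h ` {0..1})"
    using has_derivative_subset[OF f' sub] by simp
  ultimately have "((\<lambda>t. f (?h t)) has_derivative (\<lambda>t. f' (t *\<^sub>R (y - x)))) (at 0 within {0..1})"
    by (rule has_derivative_in_compose)
  moreover have "linear f'" using f' has_derivative_linear by blast
  ultimately have "((\<lambda>t. f (?h t)) has_real_derivative f' (y - x)) (at 0 within {0..1})"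
    by (simp add: has_field_derivative_def linear_scale mult.commute[of _ "f' (y - x)"])
  then have "((\<lambda>t. (f (?h t) - f x) / t) \<longlongrightarrow> f' (y - x)) (at 0 within {0..1})"
    by (simp add: has_field_derivative_iff)
  moreover have "\<forall>\<^sub>F t in at 0 within {0..1}. (f (?h t) - f x) / t \<le> f y - f x"
  proof -
    have "(f (?h t) - f x) / t \<le> f y - f x" if "0 < t" "t \<le> 1" for t
    proof -
      have "f (?h t) \<le> (1 - t) * f x + t * f y"
        unfolding h using convex_onD[OF f, of t x y] that assms(3,4) by simp
      then show ?thesis using that by (simp add: field_simps)
    qed
    then show ?thesis by (simp add: eventually_at_filter eventually_mono)
  qed
  moreover have "at (0::real) within {0..1} \<noteq> bot"
    by (simp add: at_within_Icc_at_right)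
  ultimately have "f' (y - x) \<le> f y - f x" by (rule tendsto_upperbound)
  then show ?thesis by simp
qed

section \<open>The cone and the operator \<open>F\<close>\<close>

lemma Gamma_set_sym: "Gamma_set \<Gamma> \<Longrightarrow> r \<in> \<Gamma> \<Longrightarrow> r \<in> Sym"
  unfolding Gamma_set_def by (metis openin_imp_subset subsetD)

lemma Gamma_set_add: "Gamma_set \<Gamma> \<Longrightarrow> r \<in> \<Gamma> \<Longrightarrow> s \<in> Kplus \<Longrightarrow> r + s \<in> \<Gamma>"
  unfolding Gamma_set_def by blast

text \<open>A compact part of \<open>\<Gamma>\<close> which contains all \<open>r\<close> with \<open>r - mat s \<in> \<Gamma>\<close> in a bounded set.\<close>

definition inner_part :: "(real^'n^'n) set \<Rightarrow> real \<Rightarrow> real \<Rightarrow> (real^'n^'n) set" where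
  "inner_part \<Gamma> \<rho> s = (\<lambda>r. r + mat s) ` closure (\<Gamma> \<inter> cball 0 \<rho>)"

lemma compact_inner_part: "compact (inner_part \<Gamma> \<rho> s)"
proof -
  have "compact (closure (\<Gamma> \<inter> cball 0 \<rho>))"
    by (simp add: compact_closure bounded_Int)
  then show ?thesis
    unfolding inner_part_def by (intro compact_continuous_image continuous_intros)
qed

text \<open>A point \<open>y\<close> of the closure lies within distance \<open>s\<close> of some
  \<open>r\<close> in \<Gamma>. Since \<open>y - r\<close> is symmetric,
  \<open>mat s + (y - r)\<close> is positive, and adding it to \<open>r\<close> gives
  \<open>y + mat s\<close>.\<close>

lemma inner_part_subset:
  assumes "Gamma_set \<Gamma>" "0 < s"
  shows "inner_part \<Gamma> \<rho> s \<subseteq> \<Gamma>"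
proof
  fix q assume "q \<in> inner_part \<Gamma> \<rho> s"
  then obtain y where q: "q = y + mat s" and y: "y \<in> closure (\<Gamma> \<inter> cball 0 \<rho>)"
    by (auto simp: inner_part_def)
  obtain r where r: "r \<in> \<Gamma>" "norm (y - r) < s"
    using y assms(2) unfolding closure_approachable by (metis IntD1 dist_norm norm_minus_commute)
  have "closure (\<Gamma> \<inter> cball 0 \<rho>) \<subseteq> Sym"
    by (intro closure_minimal closed_Sym) (use Gamma_set_sym[OF assms(1)] in auto)
  then have "y - r \<in> Sym"
    using y r Gamma_set_sym[OF assms(1)] by (blast intro: Sym_diff)
  from Gamma_set_add[OF assms(1) r(1) mat_add_in_Kplus[OF this r(2)]]
  show "q \<in> \<Gamma>" by (simp add: q add.commute)
qed

lemma inner_partI: "r - mat s \<in> \<Gamma> \<Longrightarrow> norm (r - mat s) \<le> \<rho> \<Longrightarrow> r \<in> inner_part \<Gamma> \<rho> s"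
  unfolding inner_part_def by (rule image_eqI[of _ _ "r - mat s"]) (auto intro!: closure_subset[THEN subsetD])

lemma C1_on_continuous: "C1_on \<Gamma> F \<Longrightarrow> continuous_on \<Gamma> F"
  unfolding C1_on_def continuous_on_eq_continuous_within
  by (blast intro: has_derivative_continuous)

lemma concave_tangent:
  assumes "C1_on \<Gamma> F" "F2 \<Gamma> F" "r \<in> \<Gamma>" "s \<in> \<Gamma>"
  shows "F s - F r \<le> Fr F r \<bullet> (s - r)"
proof -
  have "convex_on \<Gamma> (\<lambda>r. - F r)"
    using assms(2) by (simp add: F2_def concave_on_def)
  moreover have "((\<lambda>r. - F r) has_derivative (\<lambda>h. - (Fr F r \<bullet> h))) (at r within \<Gamma>)"
    using assms(1,3) by (auto simp: C1_on_def intro!: derivative_intros)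
  ultimately show ?thesis
    using convex_on_above_tangent[OF _ _ assms(3,4)] by fastforce
qed

section \<open>Functions in \<open>C\<^sup>2\<close> of the closed domain\<close>

text \<open>A limit within \<Omega> is determined only at limit points of \<Omega>. Openness makes
  every interior point one, and the remaining points of the closure are limit points by
  definition.\<close>

lemma Lim_eq_extension:
  fixes G :: "real^'n \<Rightarrow> 'b::t2_space"
  assumes "open \<Omega>" "continuous_on (closure \<Omega>) G" "\<And>x. x \<in> \<Omega> \<Longrightarrow> G x = g x" "x \<in> closure \<Omega>"
  shows "Lim (at x within \<Omega>) g = G x"
proof (rule tendsto_Lim)
  show "at x within \<Omega> \<noteq> bot"
  proof (cases "x \<in> \<Omega>")
    case True
    then have "x islimpt \<Omega>" using assms(1) by (metis interior_limit_point interior_open)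
    then show ?thesis by (simp add: trivial_limit_within)
  next
    case False
    then have "x islimpt \<Omega>" using assms(4) by (simp add: closure_def)
    then show ?thesis by (simp add: trivial_limit_within)
  qed
  have "(G \<longlongrightarrow> G x) (at x within \<Omega>)"
    using assms(2,4) by (metis closure_subset continuous_on_def tendsto_within_subset)
  moreover have "\<forall>\<^sub>F y in at x within \<Omega>. G y = g y"
    using assms(3) by (simp add: eventually_at_filter)
  ultimately show "(g \<longlongrightarrow> G x) (at x within \<Omega>)"
    by (rule Lim_transform_eventually)
qed

lemma gradc_hessc_eq:
  assumes "open \<Omega>"
    and "continuous_on (closure \<Omega>) G" "\<And>x. x \<in> \<Omega> \<Longrightarrow> G x = grad u x"
    and "continuous_on (closure \<Omega>) H" "\<And>x. x \<in> \<Omega> \<Longrightarrow> H x = hess u x" "x \<in> closure \<Omega>"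
  shows "gradc \<Omega> u x = G x" "hessc \<Omega> u x = H x"
  unfolding gradc_def hessc_def using assms by (auto intro!: Lim_eq_extension)

lemma C2_closureD:
  assumes "open \<Omega>" "C2_closure \<Omega> u"
  shows "continuous_on (closure \<Omega>) u"
    and "\<And>x. x \<in> \<Omega> \<Longrightarrow> u differentiable (at x)"
    and "\<And>x k. x \<in> \<Omega> \<Longrightarrow> pd k u differentiable (at x)"
    and "continuous_on (closure \<Omega>) (gradc \<Omega> u)" "continuous_on (closure \<Omega>) (hessc \<Omega> u)"
    and "\<And>x. x \<in> \<Omega> \<Longrightarrow> gradc \<Omega> u x = grad u x" "\<And>x. x \<in> \<Omega> \<Longrightarrow> hessc \<Omega> u x = hess u x"
proof -
  obtain G H where GH: "continuous_on (closure \<Omega>) G" "\<And>x. x \<in> \<Omega> \<Longrightarrow> G x = grad u x"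
    "continuous_on (closure \<Omega>) H" "\<And>x. x \<in> \<Omega> \<Longrightarrow> H x = hess u x"
    using assms(2) unfolding C2_closure_def by metis
  note eq = gradc_hessc_eq[OF assms(1) GH]
  show "continuous_on (closure \<Omega>) (gradc \<Omega> u)" "continuous_on (closure \<Omega>) (hessc \<Omega> u)"
    using GH eq by (simp_all cong: continuous_on_cong)
  show "\<And>x. x \<in> \<Omega> \<Longrightarrow> gradc \<Omega> u x = grad u x" "\<And>x. x \<in> \<Omega> \<Longrightarrow> hessc \<Omega> u x = hess u x"
    using eq GH closure_subset by fastforce+
qed (use assms(2) in \<open>auto simp: C2_closure_def\<close>)

lemma C2_closure_bounded:
  assumes "open \<Omega>" "bounded \<Omega>" "C2_closure \<Omega> u"
  obtains c where "0 < c" "\<And>x. x \<in> closure \<Omega> \<Longrightarrow> \<bar>u x\<bar> \<le> c"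
    "\<And>x. x \<in> closure \<Omega> \<Longrightarrow> norm (gradc \<Omega> u x) \<le> c" "\<And>x. x \<in> closure \<Omega> \<Longrightarrow> norm (hessc \<Omega> u x) \<le> c"
proof -
  note C = C2_closureD[OF assms(1,3)]
  have "compact (closure \<Omega>)" using assms(2) by simp
  then have "bounded (u ` closure \<Omega>)" "bounded (gradc \<Omega> u ` closure \<Omega>)" "bounded (hessc \<Omega> u ` closure \<Omega>)"
    using C by (auto intro!: compact_imp_bounded compact_continuous_image)
  then obtain a b c where "\<forall>x\<in>closure \<Omega>. \<bar>u x\<bar> \<le> a"
    "\<forall>x\<in>closure \<Omega>. norm (gradc \<Omega> u x) \<le> b" "\<forall>x\<in>closure \<Omega>. norm (hessc \<Omega> u x) \<le> c"
    unfolding bounded_iff by (simp only: ball_simps real_norm_def) blast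
  then show ?thesis
    by (intro that[of "max 1 (max a (max b c))"]) fastforce+
qed

text \<open>The value of \<open>u\<close> is bounded up to the boundary because
  \<open>M_u[w]\<close> is considered on the whole closure; the gradient of \<open>u\<close> enters
  only at points of \<Omega>.\<close>

lemma norm1_bounds:
  assumes "open \<Omega>" "bounded \<Omega>" "C2_closure \<Omega> u" "norm1 \<Omega> u \<le> R"
  shows "x \<in> closure \<Omega> \<Longrightarrow> \<bar>u x\<bar> \<le> R" and "x \<in> \<Omega> \<Longrightarrow> norm (grad u x) \<le> R"
proof -
  note C = C2_closureD[OF assms(1,3)]
  obtain c where c: "\<And>x. x \<in> closure \<Omega> \<Longrightarrow> \<bar>u x\<bar> \<le> c" "\<And>x. x \<in> closure \<Omega> \<Longrightarrow> norm (gradc \<Omega> u x) \<le> c"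
    using C2_closure_bounded[OF assms(1-3)] by metis
  \<comment> \<open>A real supremum carries information only for sets that are bounded above, so a
    qualitative bound by compactness has to precede the bound by \<open>R\<close>.\<close>
  have bdd: "bdd_above ((\<lambda>x. \<bar>u x\<bar>) ` \<Omega>)" "bdd_above ((\<lambda>x. norm (grad u x)) ` \<Omega>)"
    using c C(6) closure_subset[of \<Omega>] by (fastforce intro!: bdd_aboveI2[where M = c])+
  have le: "\<bar>u y\<bar> \<le> (SUP x\<in>\<Omega>. \<bar>u x\<bar>)" "norm (grad u y) \<le> (SUP x\<in>\<Omega>. norm (grad u x))" if "y \<in> \<Omega>" for y
    using that bdd by (auto intro: cSUP_upper)
  have R: "\<bar>u y\<bar> \<le> R" "norm (grad u y) \<le> R" if "y \<in> \<Omega>" for y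
    using le[OF that] assms(4) unfolding norm1_def by (smt (verit) norm_ge_zero)+
  show "x \<in> \<Omega> \<Longrightarrow> norm (grad u x) \<le> R" by (rule R)
  show "x \<in> closure \<Omega> \<Longrightarrow> \<bar>u x\<bar> \<le> R"
    using continuous_on_closure_norm_le[OF C(1), of R x] R(1) by simp
qed

lemma Mop_interior:
  assumes "open \<Omega>" "C2_closure \<Omega> v" "x \<in> \<Omega>"
  shows "Mop \<Omega> A u v x = hess v x - A x (u x) (grad v x)"
  using C2_closureD[OF assms(1,2)] assms(3) by (simp add: Mop_def)

section \<open>Dependence of \<open>A\<close> and \<open>B\<close> on the gradient\<close>

definition Adir :: "(real^'n \<Rightarrow> real \<Rightarrow> real^'n \<Rightarrow> real^'n^'n) \<Rightarrow> real^'n \<Rightarrow> real \<Rightarrow> real^'n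
    \<Rightarrow> real^'n \<Rightarrow> real^'n^'n" where
  "Adir A x z p e = (\<chi> i j. \<Sum>k\<in>UNIV. Ap A k i j x z p * e $ k)"

definition Adir2 :: "(real^'n \<Rightarrow> real \<Rightarrow> real^'n \<Rightarrow> real^'n^'n) \<Rightarrow> real^'n \<Rightarrow> real \<Rightarrow> real^'n
    \<Rightarrow> real^'n \<Rightarrow> real^'n^'n" where
  "Adir2 A x z p e = (\<chi> i j. \<Sum>k\<in>UNIV. \<Sum>l\<in>UNIV. App A k l i j x z p * e $ k * e $ l)"

text \<open>Contraction with a fixed matrix \<open>a\<close> makes the function scalar, so one
  intermediate point \<open>t\<close> serves all entries at once. The price is that \<open>t\<close>
  depends on \<open>a\<close>.\<close>

lemma A_taylor:
  assumes A: "A_smooth \<Omega> A" and x: "x \<in> closure \<Omega>"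
  shows "\<exists>t\<in>{0..1}. a \<bullet> A x z (p + e) = a \<bullet> A x z p + a \<bullet> Adir A x z p e
    + (a \<bullet> Adir2 A x z (p + t *\<^sub>R e) e) / 2"
proof -
  \<comment> \<open>The value and its derivatives as one sequence, the shape in which Maclaurin's
    formula takes them. The last branch is meant for index 2; larger indices are never
    reached.\<close>
  define g where "g m s = (if m = 0 then a \<bullet> A x z (p + s *\<^sub>R e)
    else if m = 1 then a \<bullet> Adir A x z (p + s *\<^sub>R e) e else a \<bullet> Adir2 A x z (p + s *\<^sub>R e) e)"
    for m :: nat and s :: real
  have d0: "((\<lambda>s. A x z (p + s *\<^sub>R e) $ i $ j) has_real_derivative Adir A x z (p + s *\<^sub>R e) e $ i $ j) (at s)" for s i j
    using pd_line[of "\<lambda>q. A x z q $ i $ j" p s e] A x unfolding A_smooth_def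
    by (simp add: Adir_def Ap_def)
  have d1: "((\<lambda>s. Adir A x z (p + s *\<^sub>R e) e $ i $ j) has_real_derivative Adir2 A x z (p + s *\<^sub>R e) e $ i $ j) (at s)" for s i j
  proof -
    have "((\<lambda>s. Ap A l i j x z (p + s *\<^sub>R e)) has_real_derivative (\<Sum>k\<in>UNIV. App A k l i j x z (p + s *\<^sub>R e) * e $ k)) (at s)" for l
      using pd_line[of "\<lambda>q. Ap A l i j x z q" p s e] A x unfolding A_smooth_def
      by (simp add: App_def)
    then have "((\<lambda>s. \<Sum>l\<in>UNIV. Ap A l i j x z (p + s *\<^sub>R e) * e $ l) has_real_derivative
        (\<Sum>l\<in>UNIV. (\<Sum>k\<in>UNIV. App A k l i j x z (p + s *\<^sub>R e) * e $ k) * e $ l)) (at s)"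
      by (intro DERIV_sum DERIV_cmult_right)
    moreover have "(\<Sum>l\<in>UNIV. (\<Sum>k\<in>UNIV. App A k l i j x z (p + s *\<^sub>R e) * e $ k) * e $ l)
        = Adir2 A x z (p + s *\<^sub>R e) e $ i $ j"
      unfolding Adir2_def sum_distrib_right by (subst sum.swap) simp
    ultimately show ?thesis by (simp add: Adir_def)
  qed
  have "\<forall>m t. m < 2 \<and> 0 \<le> t \<and> t \<le> 1 \<longrightarrow> DERIV (g m) t :> g (Suc m) t"
  proof (intro allI impI)
    fix m :: nat and t :: real assume "m < 2 \<and> 0 \<le> t \<and> t \<le> 1"
    then consider "m = 0" | "m = 1" by linarith
    then show "DERIV (g m) t :> g (Suc m) t"
      by cases (simp_all add: g_def[abs_def] inner_matrix_eq_sum, (intro DERIV_sum DERIV_cmult d0 d1)+)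
  qed
  from Maclaurin[of 1 2 g "g 0", OF _ _ _ this] obtain t where
    "0 < t" "t < 1" "g 0 1 = g 0 0 + g 1 0 + g 2 t / 2"
    by (auto simp: numeral_2_eq_2)
  then show ?thesis by (intro bexI[of _ t]) (simp_all add: g_def)
qed

section \<open>Bounds for \<open>A\<close> and \<open>B\<close> on compact sets of arguments\<close>

lemma continuous_on_bound:
  fixes f :: "(real^'n) \<times> real \<times> (real^'n) \<Rightarrow> 'b::real_normed_vector"
  assumes "bounded \<Omega>" "continuous_on (closure \<Omega> \<times> UNIV \<times> UNIV) f"
  shows "\<exists>c. \<forall>x z p. x \<in> closure \<Omega> \<longrightarrow> \<bar>z\<bar> \<le> P \<longrightarrow> norm p \<le> P \<longrightarrow> norm (f (x, z, p)) \<le> c"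
proof -
  have "compact (closure \<Omega> \<times> (cball 0 P :: real set) \<times> (cball 0 P :: (real^'n) set))"
    using assms(1) by (intro compact_Times) auto
  moreover have "continuous_on (closure \<Omega> \<times> cball 0 P \<times> cball 0 P) f"
    by (rule continuous_on_subset[OF assms(2)]) auto
  ultimately have "compact (f ` (closure \<Omega> \<times> cball 0 P \<times> cball 0 P))"
    by (intro compact_continuous_image)
  then show ?thesis
    by (fastforce dest!: compact_imp_bounded simp: bounded_iff)
qed

lemma abs_component_le_norm: "\<bar>(e :: real^'n) $ k\<bar> \<le> norm e"
  using component_le_norm_cart[of e k] by simp

lemma A_bounds:
  assumes "bounded \<Omega>" "A_smooth \<Omega> A"
  shows "\<exists>c>0. \<forall>x\<in>closure \<Omega>. \<forall>z p. \<bar>z\<bar> \<le> P \<longrightarrow> norm p \<le> P \<longrightarrow>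
    norm (A x z p) \<le> c \<and> (\<forall>e. norm (Adir2 A x z p e) \<le> c * (norm e)\<^sup>2)"
proof -
  obtain c0 where c0: "\<And>x z p. x \<in> closure \<Omega> \<Longrightarrow> \<bar>z\<bar> \<le> P \<Longrightarrow> norm p \<le> P \<Longrightarrow> norm (A x z p) \<le> c0"
    using continuous_on_bound[OF assms(1), of "\<lambda>(x,z,p). A x z p" P] assms(2)
    unfolding A_smooth_def by auto
  have "\<forall>k l i j. \<exists>c. \<forall>x z p. x \<in> closure \<Omega> \<longrightarrow> \<bar>z\<bar> \<le> P \<longrightarrow> norm p \<le> P \<longrightarrow> \<bar>App A k l i j x z p\<bar> \<le> c"
    using continuous_on_bound[OF assms(1), of "\<lambda>(x,z,p). App A _ _ _ _ x z p" P] assms(2)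
    unfolding A_smooth_def by auto
  then obtain c where c: "\<And>k l i j x z p. x \<in> closure \<Omega> \<Longrightarrow> \<bar>z\<bar> \<le> P \<Longrightarrow> norm p \<le> P
      \<Longrightarrow> \<bar>App A k l i j x z p\<bar> \<le> c k l i j"
    by metis
  define c1 where "c1 = (\<Sum>i\<in>UNIV. \<Sum>j\<in>UNIV. \<Sum>k\<in>UNIV. \<Sum>l\<in>UNIV. c k l i j)"
  have "norm (Adir2 A x z p e) \<le> c1 * (norm e)\<^sup>2"
    if "x \<in> closure \<Omega>" "\<bar>z\<bar> \<le> P" "norm p \<le> P" for x z p e
  proof -
    have e: "\<bar>e $ k * e $ l\<bar> \<le> (norm e)\<^sup>2" for k l
      by (simp add: abs_mult power2_eq_square mult_mono abs_component_le_norm)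
    have "\<bar>App A k l i j x z p * e $ k * e $ l\<bar> \<le> c k l i j * (norm e)\<^sup>2" for k l i j
      using mult_mono[OF c[OF that, of k l i j] e[of k l]] c[OF that, of k l i j]
      by (simp add: abs_mult mult.assoc)
    then have "\<bar>\<Sum>k\<in>UNIV. \<Sum>l\<in>UNIV. App A k l i j x z p * e $ k * e $ l\<bar>
        \<le> (\<Sum>k\<in>UNIV. \<Sum>l\<in>UNIV. c k l i j * (norm e)\<^sup>2)" for i j
      by (intro order_trans[OF sum_abs] sum_mono)
    then have "(\<Sum>i\<in>UNIV. \<Sum>j\<in>UNIV. \<bar>Adir2 A x z p e $ i $ j\<bar>) \<le> c1 * (norm e)\<^sup>2"
      unfolding c1_def sum_distrib_right by (simp add: Adir2_def sum_mono)
    moreover have "norm (Adir2 A x z p e) \<le> (\<Sum>i\<in>UNIV. \<Sum>j\<in>UNIV. \<bar>Adir2 A x z p e $ i $ j\<bar>)"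
      unfolding norm_vec_def[of "Adir2 A x z p e"]
      by (rule order_trans[OF L2_set_le_sum]) (auto intro!: sum_mono norm_le_l1_cart)
    ultimately show ?thesis by linarith
  qed
  then have "norm (Adir2 A x z p e) \<le> max 1 (max c0 c1) * (norm e)\<^sup>2"
    if "x \<in> closure \<Omega>" "\<bar>z\<bar> \<le> P" "norm p \<le> P" for x z p e
    using that by (smt (verit) max.cobounded2 mult_right_mono zero_le_power2)
  with c0 show ?thesis
    by (intro exI[of _ "max 1 (max c0 c1)"]) (auto simp: le_max_iff_disj)
qed

text \<open>The data provide bounds for \<open>A\<close> and its second derivatives in
  \<open>p\<close>. A bound for the first derivatives follows by interpolation: Taylor's formula
  with a unit step in the direction of \<open>h\<close> expresses them through the other two. A
  second expansion with the step \<open>h\<close> gives the claim; the radius \<open>P + 1\<close>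
  leaves room for both steps.\<close>

lemma A_lipschitz:
  assumes "bounded \<Omega>" "A_smooth \<Omega> A"
  shows "\<exists>c>0. \<forall>x\<in>closure \<Omega>. \<forall>z p h. \<bar>z\<bar> \<le> P \<longrightarrow> norm p \<le> P \<longrightarrow> norm h \<le> 1 \<longrightarrow>
    norm (A x z (p + h) - A x z p) \<le> c * norm h"
proof -
  obtain c where c: "0 < c" "\<And>x z p. x \<in> closure \<Omega> \<Longrightarrow> \<bar>z\<bar> \<le> P + 1 \<Longrightarrow> norm p \<le> P + 1 \<Longrightarrow>
    norm (A x z p) \<le> c" "\<And>x z p e. x \<in> closure \<Omega> \<Longrightarrow> \<bar>z\<bar> \<le> P + 1 \<Longrightarrow> norm p \<le> P + 1 \<Longrightarrow>
    norm (Adir2 A x z p e) \<le> c * (norm e)\<^sup>2"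
    using A_bounds[OF assms, of "P + 1"] by metis
  have "norm (A x z (p + h) - A x z p) \<le> 3 * c * norm h"
    if x: "x \<in> closure \<Omega>" and z: "\<bar>z\<bar> \<le> P" and p: "norm p \<le> P" and h: "norm h \<le> 1" for x z p h
  proof (cases "h = 0")
    case False
    \<comment> \<open>Contracting with the difference itself recovers the square of its norm from
      scalar expansions.\<close>
    define a where "a = A x z (p + h) - A x z p"
    define e where "e = h /\<^sub>R norm h"
    have e: "norm e = 1" "h = norm h *\<^sub>R e" using False by (auto simp: e_def)
    have quad: "\<bar>a \<bullet> Adir2 A x z (p + t *\<^sub>R y) y\<bar> \<le> norm a * c * norm y" if "norm y \<le> 1" "t \<in> {0..1}" for t y
    proof -
      have "norm (t *\<^sub>R y) \<le> 1" using that by (simp add: mult_le_one)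
      then have "norm (p + t *\<^sub>R y) \<le> P + 1" using p by (smt (verit) norm_triangle_ineq)
      then have "norm (Adir2 A x z (p + t *\<^sub>R y) y) \<le> c * (norm y)\<^sup>2" using c(3) x z by simp
      also have "\<dots> \<le> c * norm y"
        using that(1) c(1) by (simp add: power2_eq_square mult_left_le)
      finally have "norm a * norm (Adir2 A x z (p + t *\<^sub>R y) y) \<le> norm a * (c * norm y)"
        by (simp add: mult_left_mono)
      then show ?thesis
        using Cauchy_Schwarz_ineq2[of a "Adir2 A x z (p + t *\<^sub>R y) y"] by (simp add: mult.assoc)
    qed
    have val: "\<bar>a \<bullet> A x z q\<bar> \<le> norm a * c" if "norm q \<le> P + 1" for q
      using Cauchy_Schwarz_ineq2[of a "A x z q"] mult_left_mono[OF c(2)[OF x _ that, of z], of "norm a"] z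
      by simp
    obtain t where t: "t \<in> {0..1}" "a \<bullet> A x z (p + e) = a \<bullet> A x z p + a \<bullet> Adir A x z p e
        + (a \<bullet> Adir2 A x z (p + t *\<^sub>R e) e) / 2"
      using A_taylor[OF assms(2) x] by blast
    have "norm (p + e) \<le> P + 1" using p e(1) by (smt (verit) norm_triangle_ineq)
    \<comment> \<open>The factor 5/2 counts two values of \<open>A\<close> and half a second order
      term. The half from the second expansion raises it to the final 3.\<close>
    with t val[of "p + e"] val[of p] p quad[of e t] e(1)
    have dir: "\<bar>a \<bullet> Adir A x z p e\<bar> \<le> norm a * c * (5/2)" by simp
    have "Adir A x z p h = norm h *\<^sub>R Adir A x z p e"
      by (subst e(2)) (simp add: Adir_def vec_eq_iff sum_distrib_left mult_ac)
    then have "\<bar>a \<bullet> Adir A x z p h\<bar> \<le> norm h * (norm a * c * (5/2))"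
      using mult_left_mono[OF dir norm_ge_zero[of h]] by (simp add: abs_mult)
    moreover obtain s where s: "s \<in> {0..1}" "a \<bullet> A x z (p + h) = a \<bullet> A x z p + a \<bullet> Adir A x z p h
        + (a \<bullet> Adir2 A x z (p + s *\<^sub>R h) h) / 2"
      using A_taylor[OF assms(2) x] by blast
    ultimately have "a \<bullet> A x z (p + h) - a \<bullet> A x z p \<le> norm h * (norm a * c * (5/2)) + norm a * c * norm h / 2"
      using quad[OF h s(1)] by linarith
    then have "norm a * norm a \<le> norm a * (3 * c * norm h)"
      by (simp add: a_def flip: inner_diff_right dot_square_norm power2_eq_square) (simp add: algebra_simps)
    then show ?thesis
      using c(1) by (cases "a = 0") (auto simp flip: a_def)
  qed simp
  with c(1) show ?thesis by (intro exI[of _ "3 * c"]) simp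
qed

text \<open>Regularity controls the quadratic Taylor term only in directions orthogonal to \<open>q - p\<close>; the
  remaining directions are absorbed by the rank one form of \<open>q - p\<close>.\<close>

lemma regular_remainder:
  assumes "bounded \<Omega>" "A_smooth \<Omega> A" "A_regular \<Omega> A" "0 < \<epsilon>"
  shows "\<exists>C>0. \<forall>x\<in>closure \<Omega>. \<forall>z p q a. \<bar>z\<bar> \<le> P \<longrightarrow> norm p \<le> P \<longrightarrow> norm q \<le> P \<longrightarrow> psd a \<longrightarrow>
    - \<epsilon> * trace a - C * (a \<bullet> outer (q - p)) \<le> a \<bullet> (A x z q - A x z p - Adir A x z p (q - p))"
proof -
  obtain c where c: "0 < c" "\<And>x z p e. x \<in> closure \<Omega> \<Longrightarrow> \<bar>z\<bar> \<le> P \<Longrightarrow> norm p \<le> P \<Longrightarrow>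
    norm (Adir2 A x z p e) \<le> c * (norm e)\<^sup>2"
    using A_bounds[OF assms(1,2), of P] by metis
  \<comment> \<open>Here \<open>2 * P\<close> bounds \<open>norm (q - p)\<close>. The weight is
    \<open>2 * \<epsilon>\<close> because Taylor's formula halves the quadratic term, and the
    summand 1 makes the constant positive.\<close>
  define C where "C = (c * (2 * P))\<^sup>2 / (2 * \<epsilon>) / 2 + 1"
  have "- \<epsilon> * trace a - C * (a \<bullet> outer (q - p)) \<le> a \<bullet> (A x z q - A x z p - Adir A x z p (q - p))"
    if x: "x \<in> closure \<Omega>" and z: "\<bar>z\<bar> \<le> P" and p: "norm p \<le> P" and q: "norm q \<le> P" and a: "psd a"
    for x z p q a
  proof -
    define e where "e = q - p"
    have e: "norm e \<le> 2 * P" using p q norm_triangle_ineq4[of q p] by (simp add: e_def)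
    obtain t where t: "t \<in> {0..1}" "a \<bullet> A x z (p + e) = a \<bullet> A x z p + a \<bullet> Adir A x z p e
        + (a \<bullet> Adir2 A x z (p + t *\<^sub>R e) e) / 2"
      using A_taylor[OF assms(2) x] by blast
    have "p + t *\<^sub>R e = (1 - t) *\<^sub>R p + t *\<^sub>R q" by (simp add: e_def algebra_simps)
    moreover have "(1 - t) *\<^sub>R p + t *\<^sub>R q \<in> cball 0 P"
      using t(1) p q by (intro convexD_alt[OF convex_cball]) auto
    ultimately have pt: "norm (p + t *\<^sub>R e) \<le> P" by simp
    have reg: "0 \<le> \<xi> \<bullet> (Adir2 A x z (p + t *\<^sub>R e) e *v \<xi>)" if "\<xi> \<bullet> e = 0" for \<xi>
    proof -
      have "0 \<le> (\<Sum>i\<in>UNIV. \<Sum>j\<in>UNIV. \<Sum>k\<in>UNIV. \<Sum>l\<in>UNIV.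
          App A k l i j x z (p + t *\<^sub>R e) * \<xi> $ i * \<xi> $ j * e $ k * e $ l)"
        using assms(3) x that unfolding A_regular_def by blast
      then show ?thesis
        by (simp add: matrix_form_eq_sum Adir2_def sum_distrib_left mult_ac)
    qed
    have nn: "0 \<le> a \<bullet> outer e" using a by (simp add: inner_outer psd_def)
    have "- (2 * \<epsilon>) * trace a - (c * norm e)\<^sup>2 / (2 * \<epsilon>) * (a \<bullet> outer e) \<le> a \<bullet> Adir2 A x z (p + t *\<^sub>R e) e"
      by (rule inner_psd_lower_bound[OF a c(2)[OF x z pt] _ _ reg]) (use c(1) assms(4) in auto)
    moreover have "(c * norm e)\<^sup>2 / (2 * \<epsilon>) * (a \<bullet> outer e) \<le> (c * (2 * P))\<^sup>2 / (2 * \<epsilon>) * (a \<bullet> outer e)"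
      using e c(1) assms(4) nn by (intro mult_right_mono divide_right_mono power_mono mult_left_mono) auto
    ultimately have "- \<epsilon> * trace a - C * (a \<bullet> outer e) \<le> (a \<bullet> Adir2 A x z (p + t *\<^sub>R e) e) / 2"
      using nn by (simp add: C_def algebra_simps)
    also have "\<dots> = a \<bullet> (A x z (p + e) - A x z p - Adir A x z p e)"
      using t(2) by (simp add: inner_diff_right)
    finally show ?thesis by (simp add: e_def)
  qed
  moreover have "0 < C" using assms(4) by (simp add: C_def add_nonneg_pos)
  ultimately show ?thesis by blast
qed

lemma B_tangent:
  assumes "B_smooth \<Omega> B" "B_convex \<Omega> B" "x \<in> closure \<Omega>"
  shows "(\<Sum>k\<in>UNIV. pd k (B x z) p * (q - p) $ k) \<le> B x z q - B x z p"
proof -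
  have "B x z differentiable (at p)" "convex_on UNIV (B x z)"
    using assms unfolding B_smooth_def B_convex_def by blast+
  from convex_on_above_tangent[OF this(2) has_derivative_pd[OF this(1)], of q]
  show ?thesis by simp
qed

text \<open>The first derivatives in \<open>p\<close> are continuous here, so they are bounded on
  compact sets and the mean value theorem along the segment suffices.\<close>

lemma B_lipschitz:
  assumes "bounded \<Omega>" "B_smooth \<Omega> B"
  shows "\<exists>c>0. \<forall>x\<in>closure \<Omega>. \<forall>z p h. \<bar>z\<bar> \<le> P \<longrightarrow> norm p \<le> P \<longrightarrow> norm h \<le> 1 \<longrightarrow>
    \<bar>B x z (p + h) - B x z p\<bar> \<le> c * norm h"
proof -
  have "\<forall>k. \<exists>c. \<forall>x z p. x \<in> closure \<Omega> \<longrightarrow> \<bar>z\<bar> \<le> P + 1 \<longrightarrow> norm p \<le> P + 1 \<longrightarrow> \<bar>pd k (B x z) p\<bar> \<le> c"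
    using continuous_on_bound[OF assms(1), of "\<lambda>(x,z,p). pd _ (B x z) p" "P + 1"] assms(2)
    unfolding B_smooth_def by auto
  then obtain c where c: "\<And>k x z p. x \<in> closure \<Omega> \<Longrightarrow> \<bar>z\<bar> \<le> P + 1 \<Longrightarrow> norm p \<le> P + 1
      \<Longrightarrow> \<bar>pd k (B x z) p\<bar> \<le> c k"
    by metis
  have "\<bar>B x z (p + h) - B x z p\<bar> \<le> (\<bar>\<Sum>k\<in>UNIV. c k\<bar> + 1) * norm h"
    if x: "x \<in> closure \<Omega>" and z: "\<bar>z\<bar> \<le> P" and p: "norm p \<le> P" and h: "norm h \<le> 1" for x z p h
  proof -
    have "\<exists>t. 0 < t \<and> t < 1 \<and> B x z (p + 1 *\<^sub>R h) - B x z (p + 0 *\<^sub>R h)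
        = (1 - 0) * (\<Sum>k\<in>UNIV. pd k (B x z) (p + t *\<^sub>R h) * h $ k)"
      by (rule MVT2) (use assms(2) x in \<open>auto simp: B_smooth_def intro!: pd_line\<close>)
    then obtain t where t: "0 < t" "t < 1"
      "B x z (p + h) - B x z p = (\<Sum>k\<in>UNIV. pd k (B x z) (p + t *\<^sub>R h) * h $ k)"
      by auto
    have "norm (t *\<^sub>R h) \<le> 1" using t h by (simp add: mult_le_one)
    then have pt: "norm (p + t *\<^sub>R h) \<le> P + 1" using p by (smt (verit) norm_triangle_ineq)
    have z': "\<bar>z\<bar> \<le> P + 1" using z by simp
    have "\<bar>B x z (p + h) - B x z p\<bar> \<le> (\<Sum>k\<in>UNIV. c k * norm h)"
      unfolding t(3) using c[OF x z' pt] abs_component_le_norm[of h]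
      by (intro order_trans[OF sum_abs] sum_mono) (auto simp: abs_mult intro!: mult_mono intro: order_trans[OF abs_ge_zero])
    also have "\<dots> \<le> (\<bar>\<Sum>k\<in>UNIV. c k\<bar> + 1) * norm h"
      unfolding sum_distrib_right[symmetric] by (intro mult_right_mono) auto
    finally show ?thesis .
  qed
  then show ?thesis by (intro exI[of _ "\<bar>\<Sum>k\<in>UNIV. c k\<bar> + 1"]) auto
qed

section \<open>The linearised operator on exponentials\<close>

lemma pd_exp_diff:
  assumes "f differentiable (at x)" "g differentiable (at x)"
  shows "pd k (\<lambda>y. exp (K * (f y - g y))) x = K * exp (K * (f x - g x)) * (pd k f x - pd k g x)"
    and "(\<lambda>y. exp (K * (f y - g y))) differentiable (at x)"
proof -
  obtain f' g' where D: "(f has_derivative f') (at x)" "(g has_derivative g') (at x)"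
    using assms unfolding differentiable_def by blast
  have E: "((\<lambda>y. exp (K * (f y - g y))) has_derivative (\<lambda>h. exp (K * (f x - g x)) * (K * (f' h - g' h)))) (at x)"
    by (auto intro!: derivative_eq_intros D)
  show "pd k (\<lambda>y. exp (K * (f y - g y))) x = K * exp (K * (f x - g x)) * (pd k f x - pd k g x)"
    by (simp add: pd_eq[OF E] pd_eq[OF D(1)] pd_eq[OF D(2)])
  show "(\<lambda>y. exp (K * (f y - g y))) differentiable (at x)"
    using E unfolding differentiable_def by blast
qed

lemma pd_mult:
  assumes "f differentiable (at x)" "g differentiable (at x)"
  shows "pd k (\<lambda>y. f y * g y) x = f x * pd k g x + pd k f x * g x"
    and "(\<lambda>y. f y * g y) differentiable (at x)"
proof -
  obtain f' g' where D: "(f has_derivative f') (at x)" "(g has_derivative g') (at x)"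
    using assms unfolding differentiable_def by blast
  show "pd k (\<lambda>y. f y * g y) x = f x * pd k g x + pd k f x * g x"
    by (simp add: pd_eq[OF has_derivative_mult[OF D]] pd_eq[OF D(1)] pd_eq[OF D(2)])
  show "(\<lambda>y. f y * g y) differentiable (at x)"
    using has_derivative_mult[OF D] unfolding differentiable_def by blast
qed

lemma pd_lincomb:
  assumes "f differentiable (at x)" "g differentiable (at x)"
  shows "pd k (\<lambda>y. f y + c * g y) x = pd k f x + c * pd k g x"
    and "(\<lambda>y. f y + c * g y) differentiable (at x)"
proof -
  obtain f' g' where D: "(f has_derivative f') (at x)" "(g has_derivative g') (at x)"
    using assms unfolding differentiable_def by blast
  have E: "((\<lambda>y. f y + c * g y) has_derivative (\<lambda>h. f' h + c * g' h)) (at x)"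
    by (auto intro!: derivative_eq_intros D)
  show "pd k (\<lambda>y. f y + c * g y) x = pd k f x + c * pd k g x"
    by (simp add: pd_eq[OF E] pd_eq[OF D(1)] pd_eq[OF D(2)])
  show "(\<lambda>y. f y + c * g y) differentiable (at x)"
    using E unfolding differentiable_def by blast
qed

lemma pd_const: "pd k (\<lambda>y. c) x = 0"
  by (rule pd_eq[OF has_derivative_const])

lemma pd_pd_exp_diff:
  assumes "open \<Omega>" "C2_closure \<Omega> w" "C2_closure \<Omega> u" "x \<in> \<Omega>"
  defines "e \<equiv> grad w x - grad u x"
  shows "pd i (pd j (\<lambda>y. exp (K * (w y - u y)))) x
    = K * exp (K * (w x - u x)) * ((hess w x - hess u x) $ i $ j + K * e $ i * e $ j)"
proof -
  note W = C2_closureD[OF assms(1,2)] and U = C2_closureD[OF assms(1,3)]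
  let ?\<eta> = "\<lambda>y. exp (K * (w y - u y))" and ?g = "\<lambda>y. pd j w y + (- 1) * pd j u y"
  have \<eta>: "?\<eta> differentiable (at y)" "pd k ?\<eta> y = K * ?\<eta> y * (pd k w y - pd k u y)" if "y \<in> \<Omega>" for y k
    using pd_exp_diff[OF W(2)[OF that] U(2)[OF that]] by auto
  have g: "?g differentiable (at x)"
    by (rule pd_lincomb(2)[OF W(3)[OF assms(4)] U(3)[OF assms(4)]])
  have pdg: "pd i ?g x = (hess w x - hess u x) $ i $ j"
    using pd_lincomb(1)[OF W(3)[OF assms(4)] U(3)[OF assms(4)], where k = i and c = "-1"]
    by (simp add: hess_def)
  \<comment> \<open>The summand 0 gives the function the shape \<open>f y + c * g y\<close> of the
    rule for linear combinations.\<close>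
  have "(\<lambda>y. 0 + K * (?\<eta> y * ?g y)) differentiable (at x)"
    by (intro pd_lincomb(2) pd_mult(2) \<eta>(1) g assms(4)) simp
  then have "pd i (pd j ?\<eta>) x = pd i (\<lambda>y. 0 + K * (?\<eta> y * ?g y)) x"
    by (rule pd_transform_within_open(1)[OF assms(1,4)]) (simp add: \<eta>(2))
  also have "\<dots> = K * (?\<eta> x * pd i ?g x + pd i ?\<eta> x * ?g x)"
    using \<eta>(1)[OF assms(4)] g by (simp only: pd_lincomb pd_mult pd_const differentiable_const)
  also have "\<dots> = K * exp (K * (w x - u x)) * ((hess w x - hess u x) $ i $ j + K * e $ i * e $ j)"
    unfolding pdg \<eta>(2)[OF assms(4)] by (simp add: e_def grad_def algebra_simps)
  finally show ?thesis .
qed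

lemma Lop_exp:
  fixes A :: "real^'n \<Rightarrow> real \<Rightarrow> real^'n \<Rightarrow> real^'n^'n" and F :: "real^'n^'n \<Rightarrow> real"
  assumes "open \<Omega>" "C2_closure \<Omega> w" "C2_closure \<Omega> u" "x \<in> \<Omega>"
  defines "e \<equiv> grad w x - grad u x" and "a \<equiv> Fr F (Mop \<Omega> A u u x)"
  shows "Lop \<Omega> F A u (\<lambda>y. exp (K * (w y - u y))) x
    = K * exp (K * (w x - u x)) * (a \<bullet> (Mop \<Omega> A u w x - Mop \<Omega> A u u x)
      + a \<bullet> (A x (u x) (grad w x) - A x (u x) (grad u x) - Adir A x (u x) (grad u x) e)
      + K * (a \<bullet> outer e))"
proof -
  let ?\<eta> = "\<lambda>y. exp (K * (w y - u y))" and ?k = "K * exp (K * (w x - u x))"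
  let ?X = "hess w x - hess u x + K *\<^sub>R outer e - Adir A x (u x) (grad u x) e"
  note W = C2_closureD[OF assms(1,2)] and U = C2_closureD[OF assms(1,3)]
  have "pd i (pd j ?\<eta>) x - (\<Sum>k\<in>UNIV. Ap A k i j x (u x) (grad u x) * pd k ?\<eta> x) = ?k * ?X $ i $ j" for i j
    unfolding pd_pd_exp_diff[OF assms(1-4)] pd_exp_diff(1)[OF W(2)[OF assms(4)] U(2)[OF assms(4)]]
    by (simp add: e_def outer_def Adir_def grad_def sum_distrib_left algebra_simps sum_subtractf)
  then have "Lop \<Omega> F A u ?\<eta> x = a \<bullet> (?k *\<^sub>R ?X)"
    by (simp add: Lop_def inner_matrix_eq_sum a_def)
  \<comment> \<open>Both \<open>M_u[w]\<close> and \<open>M[u]\<close> evaluate \<open>A\<close> at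
    the same value \<open>u x\<close>. Their difference therefore differs from the difference of the
    Hessians only by an increment of \<open>A\<close> in \<open>p\<close>.\<close>
  also have "?X = (Mop \<Omega> A u w x - Mop \<Omega> A u u x)
      + (A x (u x) (grad w x) - A x (u x) (grad u x) - Adir A x (u x) (grad u x) e) + K *\<^sub>R outer e"
    using assms(1-4) by (simp add: Mop_interior)
  finally show ?thesis by (simp add: inner_add_right)
qed

lemma LBop_exp:
  assumes "open \<Omega>" "C2_closure \<Omega> w" "C2_closure \<Omega> u" "x \<in> \<Omega>"
  shows "LBop \<Omega> F A B u (\<lambda>y. exp (K * (w y - u y))) x
    = Lop \<Omega> F A u (\<lambda>y. exp (K * (w y - u y))) x
      - K * exp (K * (w x - u x)) * (\<Sum>k\<in>UNIV. pd k (B x (u x)) (grad u x) * (grad w x - grad u x) $ k)"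
proof -
  note W = C2_closureD[OF assms(1,2)] and U = C2_closureD[OF assms(1,3)]
  show ?thesis
    unfolding LBop_def pd_exp_diff(1)[OF W(2)[OF assms(4)] U(2)[OF assms(4)]]
    by (simp add: grad_def sum_distrib_left mult_ac)
qed

text \<open>The exponent \<open>K\<close> is taken equal to the constant of the Taylor remainder, so
  that \<open>K * (a \<bullet> outer e)\<close> cancels the negative rank one term exactly. What
  remains of the remainder is \<open>\<epsilon> \<T>\<close>, with \<epsilon> at free
  disposal.\<close>

lemma Lop_exp_lower_bound:
  assumes "open \<Omega>" "bounded \<Omega>" "F1 \<Gamma> F" "A_smooth \<Omega> A" "A_regular \<Omega> A" "C2_closure \<Omega> w" "0 < \<epsilon>"
  obtains K where "0 < K" "\<And>u x. C2_closure \<Omega> u \<Longrightarrow> norm1 \<Omega> u \<le> R \<Longrightarrow> x \<in> \<Omega> \<Longrightarrow> Mop \<Omega> A u u x \<in> \<Gamma> \<Longrightarrow>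
    K * exp (K * (w x - u x)) * (Fr F (Mop \<Omega> A u u x) \<bullet> (Mop \<Omega> A u w x - Mop \<Omega> A u u x)
      - \<epsilon> * Tr F (Mop \<Omega> A u u x)) \<le> Lop \<Omega> F A u (\<lambda>y. exp (K * (w y - u y))) x"
proof -
  obtain cw where cw: "\<And>x. x \<in> closure \<Omega> \<Longrightarrow> norm (gradc \<Omega> w x) \<le> cw"
    using C2_closure_bounded[OF assms(1,2,6)] by metis
  obtain K where K: "0 < K" "\<And>x z p q a. x \<in> closure \<Omega> \<Longrightarrow> \<bar>z\<bar> \<le> max R cw \<Longrightarrow> norm p \<le> max R cw \<Longrightarrow>
    norm q \<le> max R cw \<Longrightarrow> psd a \<Longrightarrow>
    - \<epsilon> * trace a - K * (a \<bullet> outer (q - p)) \<le> a \<bullet> (A x z q - A x z p - Adir A x z p (q - p))"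
    using regular_remainder[OF assms(2,4,5,7), of "max R cw"] by metis
  show ?thesis
  proof (rule that[OF K(1)])
    fix u x assume u: "C2_closure \<Omega> u" "norm1 \<Omega> u \<le> R" and x: "x \<in> \<Omega>" and M: "Mop \<Omega> A u u x \<in> \<Gamma>"
    have xc: "x \<in> closure \<Omega>" using x closure_subset by blast
    have "psd (Fr F (Mop \<Omega> A u u x))"
      using assms(3) M by (simp add: F1_def Kplus_imp_psd)
    moreover have "norm (grad w x) \<le> cw"
      using cw[OF xc] C2_closureD(6)[OF assms(1,6) x] by simp
    ultimately have "- \<epsilon> * trace (Fr F (Mop \<Omega> A u u x)) - K * (Fr F (Mop \<Omega> A u u x) \<bullet> outer (grad w x - grad u x))
      \<le> Fr F (Mop \<Omega> A u u x) \<bullet> (A x (u x) (grad w x) - A x (u x) (grad u x) - Adir A x (u x) (grad u x) (grad w x - grad u x))"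
      using norm1_bounds[OF assms(1,2) u, of x] x xc by (intro K(2)) auto
    then show "K * exp (K * (w x - u x)) * (Fr F (Mop \<Omega> A u u x) \<bullet> (Mop \<Omega> A u w x - Mop \<Omega> A u u x)
      - \<epsilon> * Tr F (Mop \<Omega> A u u x)) \<le> Lop \<Omega> F A u (\<lambda>y. exp (K * (w y - u y))) x"
      unfolding Lop_exp[OF assms(1,6) u(1) x] Tr_def
      using K(1) by (intro mult_left_mono) auto
  qed
qed

section \<open>Bounds uniform over the classes of \<open>u\<close>\<close>

lemma exp_diff_bounds:
  assumes "open \<Omega>" "bounded \<Omega>" "C2_closure \<Omega> w" "0 < K"
  shows "\<exists>a>0. \<exists>b>0. \<forall>u. C2_closure \<Omega> u \<longrightarrow> norm1 \<Omega> u \<le> R \<longrightarrow>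
    (\<forall>x\<in>\<Omega>. a \<le> K * exp (K * (w x - u x)) \<and> K * exp (K * (w x - u x)) \<le> b)"
proof -
  obtain cw where cw: "\<And>x. x \<in> closure \<Omega> \<Longrightarrow> \<bar>w x\<bar> \<le> cw"
    using C2_closure_bounded[OF assms(1-3)] by metis
  define a b where "a = K * exp (K * - (cw + R))" and "b = K * exp (K * (cw + R))"
  have "0 < a" "0 < b" using assms(4) by (simp_all add: a_def b_def)
  moreover have "a \<le> K * exp (K * (w x - u x)) \<and> K * exp (K * (w x - u x)) \<le> b"
    if "C2_closure \<Omega> u" "norm1 \<Omega> u \<le> R" "x \<in> \<Omega>" for u x
  proof -
    have "x \<in> closure \<Omega>" using that(3) closure_subset by blast
    with cw norm1_bounds(1)[OF assms(1,2) that(1,2)] have "\<bar>w x - u x\<bar> \<le> cw + R"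
      by (smt (verit))
    then have "- (cw + R) \<le> w x - u x" "w x - u x \<le> cw + R" by auto
    then have "K * - (cw + R) \<le> K * (w x - u x)" "K * (w x - u x) \<le> K * (cw + R)"
      using assms(4) by (auto intro: mult_left_mono)
    then show ?thesis unfolding a_def b_def using assms(4) by (simp only: mult_le_cancel_left_pos exp_le_cancel_iff simp_thms)
  qed
  ultimately show ?thesis by blast
qed

lemma Mop_bounded:
  assumes "open \<Omega>" "bounded \<Omega>" "A_smooth \<Omega> A" "C2_closure \<Omega> w"
  shows "\<exists>c>0. \<forall>u. C2_closure \<Omega> u \<longrightarrow> norm1 \<Omega> u \<le> R \<longrightarrow> (\<forall>x\<in>closure \<Omega>. norm (Mop \<Omega> A u w x) \<le> c)"
proof -
  obtain cw where cw: "0 < cw" "\<And>x. x \<in> closure \<Omega> \<Longrightarrow> norm (gradc \<Omega> w x) \<le> cw"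
    "\<And>x. x \<in> closure \<Omega> \<Longrightarrow> norm (hessc \<Omega> w x) \<le> cw"
    using C2_closure_bounded[OF assms(1,2,4)] by metis
  obtain c where c: "0 < c" "\<And>x z p. x \<in> closure \<Omega> \<Longrightarrow> \<bar>z\<bar> \<le> max R cw \<Longrightarrow> norm p \<le> max R cw \<Longrightarrow>
    norm (A x z p) \<le> c"
    using A_bounds[OF assms(2,3), of "max R cw"] by metis
  have "norm (Mop \<Omega> A u w x) \<le> cw + c" if "C2_closure \<Omega> u" "norm1 \<Omega> u \<le> R" "x \<in> closure \<Omega>" for u x
  proof -
    have "norm (A x (u x) (gradc \<Omega> w x)) \<le> c"
      using that cw(2) norm1_bounds(1)[OF assms(1,2) that(1,2)] by (intro c(2)) (auto simp: le_max_iff_disj)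
    then show ?thesis
      using cw(3)[OF that(3)] norm_triangle_ineq4[of "hessc \<Omega> w x" "A x (u x) (gradc \<Omega> w x)"]
      unfolding Mop_def by linarith
  qed
  with c(1) cw(1) show ?thesis by (intro exI[of _ "cw + c"]) auto
qed

lemma norm_mat: "norm (mat s :: real^'n^'n) = \<bar>s\<bar> * norm (mat 1 :: real^'n^'n)"
proof -
  have "mat s = s *\<^sub>R (mat 1 :: real^'n^'n)" by (simp add: vec_eq_iff mat_def)
  then show ?thesis by simp
qed

text \<open>The set \<open>inner_part\<close> makes the constants uniform in \<open>u\<close>.  It contains \<open>M\<^sub>u[w]\<close> and its small
  shifts by multiples of the identity, although \<open>M\<^sub>u[w] - mat d\<close> itself may come arbitrarily close to
  the boundary of \<open>\<Gamma>\<close>.\<close>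

lemma admissible_in_inner_part:
  fixes \<Gamma> :: "(real^'n^'n) set"
  assumes "open \<Omega>" "bounded \<Omega>" "Gamma_set \<Gamma>" "A_smooth \<Omega> A" "C2_closure \<Omega> w" "0 < d"
  shows "\<exists>\<rho>. \<forall>u\<in>admissible_class \<Omega> \<Gamma> A w R d. \<forall>x\<in>closure \<Omega>. \<forall>h\<in>Sym.
    norm h < d / 2 \<longrightarrow> Mop \<Omega> A u w x + h \<in> inner_part \<Gamma> \<rho> (d / 2)"
proof -
  obtain c where c: "0 < c" "\<And>u x. C2_closure \<Omega> u \<Longrightarrow> norm1 \<Omega> u \<le> R \<Longrightarrow> x \<in> closure \<Omega> \<Longrightarrow> norm (Mop \<Omega> A u w x) \<le> c"
    using Mop_bounded[OF assms(1,2,4,5), of R] by metis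
  have "Mop \<Omega> A u w x + h \<in> inner_part \<Gamma> (c + d / 2 + norm (mat (d / 2) :: real^'n^'n)) (d / 2)"
    if u: "u \<in> admissible_class \<Omega> \<Gamma> A w R d" and x: "x \<in> closure \<Omega>" and h: "h \<in> Sym" "norm h < d / 2" for u x h
  proof (rule inner_partI)
    let ?N = "Mop \<Omega> A u w x"
    have N: "?N - mat d \<in> \<Gamma>" "norm ?N \<le> c"
      using u x c(2) unfolding admissible_class_def by blast+
    \<comment> \<open>One half of the margin absorbs \<open>h\<close> inside the positive cone; the
      other half remains as the shift of \<open>inner_part\<close>.\<close>
    have "(?N - mat d) + (mat (d / 2) + h) \<in> \<Gamma>"
      by (intro Gamma_set_add[OF assms(3)] N mat_add_in_Kplus h)
    moreover have "mat d = mat (d / 2) + (mat (d / 2) :: real^'n^'n)"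
      by (simp flip: mat_add)
    ultimately show "?N + h - mat (d / 2) \<in> \<Gamma>" by (simp add: algebra_simps)
    show "norm (?N + h - mat (d / 2)) \<le> c + d / 2 + norm (mat (d / 2) :: real^'n^'n)"
      using N(2) h(2) norm_triangle_ineq4[of "?N + h" "mat (d / 2)"] norm_triangle_ineq[of ?N h] by linarith
  qed
  then show ?thesis by blast
qed

text \<open>The tangent inequality at \<open>M[u]\<close> is evaluated at
  \<open>M_u[w] - mat s\<close>, and the shift contributes \<open>s \<T>\<close>. The price is a
  decrease of \<open>F\<close> from \<open>M_u[w]\<close> to the shifted matrix, kept below \<theta>
  by uniform continuity on a compact set, so \<open>s\<close> does not depend on \<open>u\<close>.
  The loss \<theta> is left free because part (ii) can afford only a fraction of the
  strictness.\<close>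

lemma concave_bracket:
  fixes \<Gamma> :: "(real^'n^'n) set"
  assumes "open \<Omega>" "bounded \<Omega>" "Gamma_set \<Gamma>" "C1_on \<Gamma> F" "F2 \<Gamma> F" "A_smooth \<Omega> A" "C2_closure \<Omega> w" "0 < d" "0 < \<theta>"
  shows "\<exists>s>0. \<forall>u\<in>admissible_class \<Omega> \<Gamma> A w R d. \<forall>x\<in>\<Omega>.
    s * Tr F (Mop \<Omega> A u u x) + F (Mop \<Omega> A u w x) - F (Mop \<Omega> A u u x) - \<theta>
      \<le> Fr F (Mop \<Omega> A u u x) \<bullet> (Mop \<Omega> A u w x - Mop \<Omega> A u u x)"
proof -
  obtain \<rho> where \<rho>: "\<And>u x h. u \<in> admissible_class \<Omega> \<Gamma> A w R d \<Longrightarrow> x \<in> closure \<Omega> \<Longrightarrow> h \<in> Sym \<Longrightarrow>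
    norm h < d / 2 \<Longrightarrow> Mop \<Omega> A u w x + h \<in> inner_part \<Gamma> \<rho> (d / 2)"
    using admissible_in_inner_part[OF assms(1-3,6-8), of R] by metis
  have sub: "inner_part \<Gamma> \<rho> (d / 2) \<subseteq> \<Gamma>"
    using assms(3,8) by (intro inner_part_subset) auto
  have "uniformly_continuous_on (inner_part \<Gamma> \<rho> (d / 2)) F"
    using compact_inner_part continuous_on_subset[OF C1_on_continuous[OF assms(4)] sub]
    by (rule compact_uniformly_continuous[rotated])
  then obtain \<gamma> where \<gamma>: "0 < \<gamma>" "\<And>r r'. r \<in> inner_part \<Gamma> \<rho> (d / 2) \<Longrightarrow> r' \<in> inner_part \<Gamma> \<rho> (d / 2) \<Longrightarrow>
    dist r' r < \<gamma> \<Longrightarrow> dist (F r') (F r) < \<theta>"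
    using assms(9) unfolding uniformly_continuous_on_def by metis
  \<comment> \<open>A shift of norm below \<tau> stays in \<open>inner_part\<close> and respects the
    modulus of continuity \<gamma>. Dividing by the norm of the identity matrix plus 1 gives
    \<open>norm (mat s) \<le> \<tau> / 2\<close>.\<close>
  define \<tau> where "\<tau> = min (d / 2) \<gamma>"
  define s where "s = \<tau> / (2 * (norm (mat 1 :: real^'n^'n) + 1))"
  have \<tau>: "0 < \<tau>" using \<gamma>(1) assms(8) by (simp add: \<tau>_def)
  have "0 < norm (mat 1 :: real^'n^'n) + 1" by (simp add: add_nonneg_pos)
  with \<tau> have s: "0 < s" by (simp add: s_def)
  have "norm (mat s :: real^'n^'n) \<le> \<tau> / 2"
    using \<tau> \<open>0 < norm _ + 1\<close> by (subst norm_mat) (simp add: s_def field_simps)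
  with \<tau> have ns: "norm (mat (- s) :: real^'n^'n) < \<tau>"
    by (simp add: norm_mat[of "- s"] norm_mat[of s])
  show ?thesis
  proof (intro exI[of _ s] conjI s ballI)
    fix u x assume u: "u \<in> admissible_class \<Omega> \<Gamma> A w R d" and x: "x \<in> \<Omega>"
    let ?M = "Mop \<Omega> A u u x" and ?N = "Mop \<Omega> A u w x"
    have xc: "x \<in> closure \<Omega>" using x closure_subset by blast
    have M: "?M \<in> \<Gamma>" using u xc by (simp add: admissible_class_def)
    have N: "?N \<in> inner_part \<Gamma> \<rho> (d / 2)"
      using \<rho>[OF u xc, of 0] assms(8) by (simp add: Sym_iff)
    have N': "?N + mat (- s) \<in> inner_part \<Gamma> \<rho> (d / 2)"
      using ns unfolding \<tau>_def by (intro \<rho>[OF u xc Sym_mat]) linarith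
    have "dist (F (?N + mat (- s))) (F ?N) < \<theta>"
      using ns by (intro \<gamma>(2)[OF N N']) (simp add: dist_norm \<tau>_def)
    then have "F ?N - \<theta> \<le> F (?N + mat (- s))" by (simp add: dist_real_def)
    moreover have "F (?N + mat (- s)) - F ?M \<le> Fr F ?M \<bullet> (?N + mat (- s) - ?M)"
      using N' sub by (intro concave_tangent[OF assms(4,5) M]) auto
    moreover have "Fr F ?M \<bullet> (?N + mat (- s) - ?M) = Fr F ?M \<bullet> (?N - ?M) - s * Tr F ?M"
      by (simp add: inner_diff_right inner_add_right inner_mat Tr_def)
    ultimately show "s * Tr F ?M + F ?N - F ?M - \<theta> \<le> Fr F ?M \<bullet> (?N - ?M)" by linarith
  qed
qed

text \<open>Supplies the constant replacing \<open>F(M_u[w])\<close> in the concave case of part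
  (i). Although \<open>F\<close> may be unbounded near the boundary of \<Gamma>, the matrices
  \<open>M_u[w]\<close> stay in a compact subset.\<close>

lemma F_bounded_below:
  assumes "open \<Omega>" "bounded \<Omega>" "Gamma_set \<Gamma>" "C1_on \<Gamma> F" "A_smooth \<Omega> A" "C2_closure \<Omega> w" "0 < d"
  shows "\<exists>c. \<forall>u\<in>admissible_class \<Omega> \<Gamma> A w R d. \<forall>x\<in>\<Omega>. - c \<le> F (Mop \<Omega> A u w x)"
proof -
  obtain \<rho> where \<rho>: "\<And>u x h. u \<in> admissible_class \<Omega> \<Gamma> A w R d \<Longrightarrow> x \<in> closure \<Omega> \<Longrightarrow> h \<in> Sym \<Longrightarrow>
    norm h < d / 2 \<Longrightarrow> Mop \<Omega> A u w x + h \<in> inner_part \<Gamma> \<rho> (d / 2)"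
    using admissible_in_inner_part[OF assms(1-3,5-7), of R] by metis
  have "inner_part \<Gamma> \<rho> (d / 2) \<subseteq> \<Gamma>"
    using assms(3,7) by (intro inner_part_subset) auto
  then have "compact (F ` inner_part \<Gamma> \<rho> (d / 2))"
    by (intro compact_continuous_image compact_inner_part continuous_on_subset[OF C1_on_continuous[OF assms(4)]])
  then obtain c where c: "\<And>r. r \<in> inner_part \<Gamma> \<rho> (d / 2) \<Longrightarrow> \<bar>F r\<bar> \<le> c"
    by (metis bounded_iff compact_imp_bounded image_eqI real_norm_def)
  have "Mop \<Omega> A u w x \<in> inner_part \<Gamma> \<rho> (d / 2)" if "u \<in> admissible_class \<Omega> \<Gamma> A w R d" "x \<in> \<Omega>" for u x
    using \<rho>[OF that(1), of x 0] that(2) closure_subset[of \<Omega>] assms(7) by (auto simp: Sym_iff)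
  with c show ?thesis by (intro exI[of _ c]) (meson abs_le_D2 minus_le_iff)
qed

lemma Fmu_bracket:
  assumes "F1 \<Gamma> F" "Fmu \<Gamma> F" "0 < d"
  shows "\<exists>c. \<forall>u\<in>positive_class \<Omega> \<Gamma> A w R d. \<forall>x\<in>\<Omega>.
    d / 2 * Tr F (Mop \<Omega> A u u x) - F (Mop \<Omega> A u u x) - c
      \<le> Fr F (Mop \<Omega> A u u x) \<bullet> (Mop \<Omega> A u w x - Mop \<Omega> A u u x)"
proof -
  \<comment> \<open>The choice \<open>\<mu> = d / 2\<close> spends half of the term
    \<open>d \<T>\<close> coming from \<open>M_u[w]\<close> and leaves the other half.\<close>
  obtain c where c: "\<And>r. r \<in> \<Gamma> \<Longrightarrow> r \<bullet> Fr F r \<le> F r + d / 2 * Tr F r + c"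
    using assms(2,3) unfolding Fmu_def by (metis half_gt_zero)
  have "d / 2 * Tr F (Mop \<Omega> A u u x) - F (Mop \<Omega> A u u x) - c
      \<le> Fr F (Mop \<Omega> A u u x) \<bullet> (Mop \<Omega> A u w x - Mop \<Omega> A u u x)"
    if u: "u \<in> positive_class \<Omega> \<Gamma> A w R d" and x: "x \<in> \<Omega>" for u x
  proof -
    let ?M = "Mop \<Omega> A u u x" and ?N = "Mop \<Omega> A u w x"
    have "x \<in> closure \<Omega>" using x closure_subset by blast
    with u have M: "?M \<in> \<Gamma>" and N: "psd (?N - mat d)" by (auto simp: positive_class_def)
    have "psd (Fr F ?M)" using assms(1) M by (simp add: F1_def Kplus_imp_psd)
    then have "0 \<le> Fr F ?M \<bullet> (?N - mat d)"
      using N by (intro psd_inner_nonneg) (auto simp: psd_def)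
    then show ?thesis
      using c[OF M] by (simp add: inner_diff_right inner_mat Tr_def inner_commute[of ?M])
  qed
  then show ?thesis by blast
qed

text \<open>Both cases of part (i) lead to the same lower bound for the first term, so the rest is
  carried out for an arbitrary class \<open>U\<close> with that bound. Half of \<open>s\<close> is
  spent on the Taylor remainder.\<close>

lemma estimate_i:
  assumes "open \<Omega>" "bounded \<Omega>" "F1 \<Gamma> F" "A_smooth \<Omega> A" "A_regular \<Omega> A" "C2_closure \<Omega> w" "0 < s"
    and U: "\<And>u. u \<in> U \<Longrightarrow> C2_closure \<Omega> u" "\<And>u. u \<in> U \<Longrightarrow> norm1 \<Omega> u \<le> R"
      "\<And>u x. u \<in> U \<Longrightarrow> x \<in> \<Omega> \<Longrightarrow> Mop \<Omega> A u u x \<in> \<Gamma>"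
      "\<And>u x. u \<in> U \<Longrightarrow> x \<in> \<Omega> \<Longrightarrow> s * Tr F (Mop \<Omega> A u u x) - F (Mop \<Omega> A u u x) - c
        \<le> Fr F (Mop \<Omega> A u u x) \<bullet> (Mop \<Omega> A u w x - Mop \<Omega> A u u x)"
  shows "\<exists>K>0. \<exists>\<delta>>0. \<exists>C>0.
        (\<forall>m. \<exists>C'>0. \<forall>u\<in>U. (\<forall>x\<in>\<Omega>. m \<le> F (Mop \<Omega> A u u x)) \<longrightarrow>
           (\<forall>x\<in>\<Omega>. Lop \<Omega> F A u (\<lambda>y. exp (K * (w y - u y))) x
              \<ge> \<delta> * Tr F (Mop \<Omega> A u u x) - C * F (Mop \<Omega> A u u x) - C')) \<and>
        (\<exists>C\<^sub>0>0. \<exists>C'>0. \<forall>u\<in>U. \<forall>x\<in>\<Omega>.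
           Lop \<Omega> F A u (\<lambda>y. exp (K * (w y - u y))) x
              \<ge> \<delta> * Tr F (Mop \<Omega> A u u x)
                 - (if F (Mop \<Omega> A u u x) \<ge> 0 then C else C\<^sub>0) * F (Mop \<Omega> A u u x) - C')"
proof -
  have s2: "0 < s / 2" using assms(7) by simp
  obtain K where K: "0 < K" "\<And>u x. C2_closure \<Omega> u \<Longrightarrow> norm1 \<Omega> u \<le> R \<Longrightarrow> x \<in> \<Omega> \<Longrightarrow> Mop \<Omega> A u u x \<in> \<Gamma> \<Longrightarrow>
    K * exp (K * (w x - u x)) * (Fr F (Mop \<Omega> A u u x) \<bullet> (Mop \<Omega> A u w x - Mop \<Omega> A u u x)
      - s / 2 * Tr F (Mop \<Omega> A u u x)) \<le> Lop \<Omega> F A u (\<lambda>y. exp (K * (w y - u y))) x"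
    using Lop_exp_lower_bound[OF assms(1-6) s2, of R] by blast
  obtain a b where ab: "0 < a" "0 < b" "\<And>u x. C2_closure \<Omega> u \<Longrightarrow> norm1 \<Omega> u \<le> R \<Longrightarrow> x \<in> \<Omega> \<Longrightarrow>
    a \<le> K * exp (K * (w x - u x)) \<and> K * exp (K * (w x - u x)) \<le> b"
    using exp_diff_bounds[OF assms(1,2,6) K(1), of R] by metis
  define c' where "c' = b * \<bar>c\<bar> + 1"
  have c': "0 < c'" using ab(2) by (simp add: c'_def add_nonneg_pos)
  have main: "a * (s / 2) * Tr F (Mop \<Omega> A u u x)
      - (if F (Mop \<Omega> A u u x) \<ge> 0 then b else a) * F (Mop \<Omega> A u u x) - c'
      \<le> Lop \<Omega> F A u (\<lambda>y. exp (K * (w y - u y))) x" if u: "u \<in> U" and x: "x \<in> \<Omega>" for u x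
  proof -
    define T where "T = Tr F (Mop \<Omega> A u u x)"
    define f where "f = F (Mop \<Omega> A u u x)"
    define k where "k = K * exp (K * (w x - u x))"
    have k: "a \<le> k" "k \<le> b" using ab(3)[OF U(1,2)[OF u] x] by (auto simp: k_def)
    have T: "0 \<le> T"
      using assms(3) U(3)[OF u x] by (simp add: T_def Tr_def trace_nonneg F1_def Kplus_imp_psd)
    have "a * (s / 2 * T) \<le> k * (s / 2 * T)" using k T assms(7) by (intro mult_right_mono) auto
    \<comment> \<open>An upper bound is wanted here, so a negative \<open>f\<close> calls for the
      lower bound \<open>a\<close> of \<open>k\<close>; this is the origin of the second
      constant.\<close>
    moreover have "k * f \<le> (if f \<ge> 0 then b else a) * f"
      using k by (auto intro: mult_right_mono mult_right_mono_neg)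
    moreover have "k * c \<le> c'"
    proof -
      have "k * c \<le> k * \<bar>c\<bar>" using k ab(1) by (intro mult_left_mono) auto
      also have "\<dots> \<le> b * \<bar>c\<bar>" using k by (intro mult_right_mono) auto
      finally show ?thesis by (simp add: c'_def)
    qed
    ultimately have "a * (s / 2) * T - (if f \<ge> 0 then b else a) * f - c' \<le> k * (s * T - f - c - s / 2 * T)"
      by (simp add: algebra_simps)
    also have "\<dots> \<le> k * (Fr F (Mop \<Omega> A u u x) \<bullet> (Mop \<Omega> A u w x - Mop \<Omega> A u u x) - s / 2 * T)"
      using U(4)[OF u x] k ab(1) by (intro mult_left_mono) (auto simp: T_def f_def)
    also have "\<dots> \<le> Lop \<Omega> F A u (\<lambda>y. exp (K * (w y - u y))) x"
      unfolding k_def T_def by (rule K(2)[OF U(1,2)[OF u] x U(3)[OF u x]])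
    finally show ?thesis by (simp add: T_def f_def)
  qed
  show ?thesis
  proof (rule exI[of _ K], intro conjI, rule K(1), rule exI[of _ "a * (s / 2)"], intro conjI, rule mult_pos_pos[OF ab(1) s2],
      rule exI[of _ b], intro conjI allI, rule ab(2))
    show "\<exists>C\<^sub>0>0. \<exists>C'>0. \<forall>u\<in>U. \<forall>x\<in>\<Omega>. Lop \<Omega> F A u (\<lambda>y. exp (K * (w y - u y))) x
      \<ge> a * (s / 2) * Tr F (Mop \<Omega> A u u x) - (if F (Mop \<Omega> A u u x) \<ge> 0 then b else C\<^sub>0) * F (Mop \<Omega> A u u x) - C'"
      using main ab(1) c' by blast
    fix m
    have "a * (s / 2) * Tr F (Mop \<Omega> A u u x) - b * F (Mop \<Omega> A u u x) - (c' + b * \<bar>m\<bar>)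
        \<le> Lop \<Omega> F A u (\<lambda>y. exp (K * (w y - u y))) x"
      if u: "u \<in> U" and x: "x \<in> \<Omega>" and m: "m \<le> F (Mop \<Omega> A u u x)" for u x
    proof -
      define f where "f = F (Mop \<Omega> A u u x)"
      \<comment> \<open>For negative \<open>f\<close> the left side is negative, while
        \<open>- f \<le> \<bar>m\<bar>\<close> makes the right side nonnegative.\<close>
      have "(if f \<ge> 0 then b else a) * f \<le> b * f + b * \<bar>m\<bar>"
      proof (cases "f \<ge> 0")
        case False
        have "b * - f \<le> b * \<bar>m\<bar>" using m ab(2) by (intro mult_left_mono) (auto simp: f_def)
        moreover have "a * f \<le> 0" using False ab(1) by (simp add: mult_nonneg_nonpos)
        ultimately show ?thesis using False by simp
      qed (use ab(2) in auto)
      then show ?thesis using main[OF u x] unfolding f_def by linarith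
    qed
    then show "\<exists>C'>0. \<forall>u\<in>U. (\<forall>x\<in>\<Omega>. m \<le> F (Mop \<Omega> A u u x)) \<longrightarrow>
           (\<forall>x\<in>\<Omega>. Lop \<Omega> F A u (\<lambda>y. exp (K * (w y - u y))) x
              \<ge> a * (s / 2) * Tr F (Mop \<Omega> A u u x) - b * F (Mop \<Omega> A u u x) - C')"
      using c' ab(2) by (intro exI[of _ "c' + b * \<bar>m\<bar>"] conjI) (auto simp: add_pos_nonneg)
  qed
qed

text \<open>The values of \<open>F\<close> at \<open>M[u]\<close> and \<open>M_u[w]\<close> produced
  by concavity cancel against those coming from the convexity of \<open>B\<close> and the two
  differential inequalities, so no \<open>\<F>[u]\<close> is left. Concavity is used with loss
  \<open>d / 2\<close>, and the other half of the strictness \<open>d\<close> yields the constant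
  summand of the estimate.\<close>

lemma estimate_ii:
  assumes "open \<Omega>" "bounded \<Omega>" "Gamma_set \<Gamma>" "C1_on \<Gamma> F" "F1 \<Gamma> F" "A_smooth \<Omega> A" "A_regular \<Omega> A"
    "B_smooth \<Omega> B" "C2_closure \<Omega> w" "F2 \<Gamma> F" "B_convex \<Omega> B" "0 < d"
  shows "\<exists>K>0. \<exists>\<delta>>0. \<forall>u\<in>admissible_class \<Omega> \<Gamma> A w R d.
    supersolution \<Omega> F A B u \<longrightarrow> subsolution \<Omega> F A B d u w \<longrightarrow>
    (\<forall>x\<in>\<Omega>. LBop \<Omega> F A B u (\<lambda>y. exp (K * (w y - u y))) x \<ge> \<delta> * (Tr F (Mop \<Omega> A u u x) + 1))"
proof -
  have d2: "0 < d / 2" using assms(12) by simp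
  obtain s where s: "0 < s" "\<And>u x. u \<in> admissible_class \<Omega> \<Gamma> A w R d \<Longrightarrow> x \<in> \<Omega> \<Longrightarrow>
    s * Tr F (Mop \<Omega> A u u x) + F (Mop \<Omega> A u w x) - F (Mop \<Omega> A u u x) - d / 2
      \<le> Fr F (Mop \<Omega> A u u x) \<bullet> (Mop \<Omega> A u w x - Mop \<Omega> A u u x)"
    using concave_bracket[OF assms(1-4,10,6,9,12) d2, of R] by metis
  have s2: "0 < s / 2" using s by simp
  obtain K where K: "0 < K" "\<And>u x. C2_closure \<Omega> u \<Longrightarrow> norm1 \<Omega> u \<le> R \<Longrightarrow> x \<in> \<Omega> \<Longrightarrow> Mop \<Omega> A u u x \<in> \<Gamma> \<Longrightarrow>
    K * exp (K * (w x - u x)) * (Fr F (Mop \<Omega> A u u x) \<bullet> (Mop \<Omega> A u w x - Mop \<Omega> A u u x)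
      - s / 2 * Tr F (Mop \<Omega> A u u x)) \<le> Lop \<Omega> F A u (\<lambda>y. exp (K * (w y - u y))) x"
    using Lop_exp_lower_bound[OF assms(1,2,5-7,9) s2, of R] by blast
  obtain a where a: "0 < a" "\<And>u x. C2_closure \<Omega> u \<Longrightarrow> norm1 \<Omega> u \<le> R \<Longrightarrow> x \<in> \<Omega> \<Longrightarrow>
    a \<le> K * exp (K * (w x - u x))"
    using exp_diff_bounds[OF assms(1,2,9) K(1), of R] by metis
  show ?thesis
  proof (rule exI[of _ K], intro conjI, rule K(1), rule exI[of _ "a * min (s / 2) (d / 2)"], intro conjI ballI impI)
    show "0 < a * min (s / 2) (d / 2)" using a(1) s2 d2 by simp
    fix u x assume u: "u \<in> admissible_class \<Omega> \<Gamma> A w R d" and sup: "supersolution \<Omega> F A B u"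
      and sub: "subsolution \<Omega> F A B d u w" and x: "x \<in> \<Omega>"
    have xc: "x \<in> closure \<Omega>" using x closure_subset by blast
    have uC: "C2_closure \<Omega> u" "norm1 \<Omega> u \<le> R" and M: "Mop \<Omega> A u u x \<in> \<Gamma>"
      using u xc by (auto simp: admissible_class_def)
    define T where "T = Tr F (Mop \<Omega> A u u x)"
    define k where "k = K * exp (K * (w x - u x))"
    define P where "P = Fr F (Mop \<Omega> A u u x) \<bullet> (Mop \<Omega> A u w x - Mop \<Omega> A u u x)"
    define D where "D = (\<Sum>k\<in>UNIV. pd k (B x (u x)) (grad u x) * (grad w x - grad u x) $ k)"
    have k: "a \<le> k" using a(2)[OF uC x] by (simp add: k_def)
    have T: "0 \<le> T"
      using assms(5) M by (simp add: T_def Tr_def trace_nonneg F1_def Kplus_imp_psd)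
    have "D \<le> B x (u x) (grad w x) - B x (u x) (grad u x)"
      unfolding D_def by (rule B_tangent[OF assms(8,11) xc])
    moreover have "F (Mop \<Omega> A u u x) \<le> B x (u x) (grad u x)"
      using sup x by (simp add: supersolution_def)
    moreover have "B x (u x) (grad w x) + d \<le> F (Mop \<Omega> A u w x)"
      using sub x by (simp add: subsolution_def)
    ultimately have br: "s / 2 * T + d / 2 \<le> P - s / 2 * T - D"
      using s(2)[OF u x] unfolding T_def[symmetric] P_def[symmetric] by simp
    have "min (s / 2) (d / 2) * (T + 1) \<le> s / 2 * T + d / 2"
      using mult_right_mono[OF min.cobounded1 T, of "s / 2" "d / 2"] by (simp add: distrib_left)
    then have "a * (min (s / 2) (d / 2) * (T + 1)) \<le> k * (P - s / 2 * T - D)"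
      using br k a(1) s2 d2 T by (intro mult_mono) auto
    also have "\<dots> = k * (P - s / 2 * T) - k * D" by (simp add: right_diff_distrib)
    also have "\<dots> \<le> LBop \<Omega> F A B u (\<lambda>y. exp (K * (w y - u y))) x"
      unfolding LBop_exp[OF assms(1,9) uC(1) x] D_def[symmetric] k_def[symmetric]
      using K(2)[OF uC x M] by (simp add: k_def P_def T_def)
    finally show "a * min (s / 2) (d / 2) * (Tr F (Mop \<Omega> A u u x) + 1)
      \<le> LBop \<Omega> F A B u (\<lambda>y. exp (K * (w y - u y))) x"
      by (simp add: T_def mult.assoc)
  qed
qed

section \<open>Strict subsolutions by perturbation\<close>

lemma C2_closure_lincomb:
  fixes c :: real
  assumes "open \<Omega>" "C2_closure \<Omega> f" "C2_closure \<Omega> g"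
  defines "h \<equiv> \<lambda>y. f y + c * g y"
  shows "C2_closure \<Omega> h"
    and "\<And>x. x \<in> closure \<Omega> \<Longrightarrow> gradc \<Omega> h x = gradc \<Omega> f x + c *\<^sub>R gradc \<Omega> g x"
    and "\<And>x. x \<in> closure \<Omega> \<Longrightarrow> hessc \<Omega> h x = hessc \<Omega> f x + c *\<^sub>R hessc \<Omega> g x"
proof -
  note f = C2_closureD[OF assms(1,2)] and g = C2_closureD[OF assms(1,3)]
  let ?p = "\<lambda>k y. pd k f y + c * pd k g y"
  have pd: "h differentiable (at x)" "pd k h x = ?p k x" if "x \<in> \<Omega>" for x k
    unfolding h_def using pd_lincomb[OF f(2)[OF that] g(2)[OF that]] by blast+
  have p: "?p k differentiable (at x)" "pd j (?p k) x = pd j (pd k f) x + c * pd j (pd k g) x" if "x \<in> \<Omega>" for x k j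
    using pd_lincomb[OF f(3)[OF that] g(3)[OF that]] by blast+
  have pd2: "pd k h differentiable (at x)" "pd j (pd k h) x = pd j (?p k) x" if "x \<in> \<Omega>" for x k j
    by (rule pd_transform_within_open[OF assms(1) that p(1)[OF that]], simp add: pd(2))+
  have grad: "gradc \<Omega> f x + c *\<^sub>R gradc \<Omega> g x = grad h x" if "x \<in> \<Omega>" for x
    using f(6) g(6) that by (simp add: grad_def pd(2) vec_eq_iff)
  have hess: "hessc \<Omega> f x + c *\<^sub>R hessc \<Omega> g x = hess h x" if "x \<in> \<Omega>" for x
    using f(7) g(7) that by (simp add: hess_def pd2(2) p(2) vec_eq_iff)
  have cont: "continuous_on (closure \<Omega>) (\<lambda>x. gradc \<Omega> f x + c *\<^sub>R gradc \<Omega> g x)"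
    "continuous_on (closure \<Omega>) (\<lambda>x. hessc \<Omega> f x + c *\<^sub>R hessc \<Omega> g x)"
    using f g by (auto intro!: continuous_intros)
  have "continuous_on (closure \<Omega>) h"
    unfolding h_def using f(1) g(1) by (auto intro!: continuous_intros)
  then show "C2_closure \<Omega> h"
    unfolding C2_closure_def using pd(1) pd2(1) cont grad hess by blast
  show "\<And>x. x \<in> closure \<Omega> \<Longrightarrow> gradc \<Omega> h x = gradc \<Omega> f x + c *\<^sub>R gradc \<Omega> g x"
    "\<And>x. x \<in> closure \<Omega> \<Longrightarrow> hessc \<Omega> h x = hessc \<Omega> f x + c *\<^sub>R hessc \<Omega> g x"
    by (rule gradc_hessc_eq[OF assms(1) cont(1) grad cont(2) hess]; assumption)+
qed

text \<open>Each differentiation contributes a factor \<kappa>, so a large \<kappa> lets the Hessian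
  dominate the gradient. The Hessian has rank one, and its pairing with \<open>F\<^sub>r\<close>
  sees only one diagonal entry.\<close>

lemma C2_closure_exp_coordinate:
  fixes \<Omega> :: "(real^'n) set" and k :: 'n and \<kappa> :: real
  assumes "open \<Omega>"
  defines "\<phi> \<equiv> \<lambda>y. exp (\<kappa> * y $ k)" and "e \<equiv> axis k 1 :: real^'n"
  shows "C2_closure \<Omega> \<phi>"
    and "\<And>x. x \<in> closure \<Omega> \<Longrightarrow> gradc \<Omega> \<phi> x = (\<kappa> * \<phi> x) *\<^sub>R e"
    and "\<And>x. x \<in> closure \<Omega> \<Longrightarrow> hessc \<Omega> \<phi> x = (\<kappa>\<^sup>2 * \<phi> x) *\<^sub>R outer e"
proof -
  have D: "((\<lambda>y. c * \<phi> y) has_derivative (\<lambda>h. c * (\<kappa> * \<phi> x) * h $ k)) (at x)" for c x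
    unfolding \<phi>_def by (auto intro!: derivative_eq_intros bounded_linear.has_derivative[OF bounded_linear_vec_nth])
  have sym: "axis j (1::real) $ k = e $ j" for j by (simp add: e_def axis_def)
  have pd: "pd j (\<lambda>y. c * \<phi> y) x = c * (\<kappa> * \<phi> x) * e $ j" for j c x
    by (simp add: pd_eq[OF D] sym)
  have diff: "(\<lambda>y. c * \<phi> y) differentiable (at x)" for c x
    using D unfolding differentiable_def by blast
  have pd1: "pd j \<phi> = (\<lambda>y. (\<kappa> * e $ j) * \<phi> y)" for j
    using pd[of j 1] by (simp add: fun_eq_iff mult_ac)
  have cont: "continuous_on (closure \<Omega>) (\<lambda>x. (\<kappa> * \<phi> x) *\<^sub>R e)"
    "continuous_on (closure \<Omega>) (\<lambda>x. (\<kappa>\<^sup>2 * \<phi> x) *\<^sub>R outer e)" "continuous_on (closure \<Omega>) \<phi>"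
    unfolding \<phi>_def by (intro continuous_intros)+
  have grad: "(\<kappa> * \<phi> x) *\<^sub>R e = grad \<phi> x" for x
    by (simp add: vec_eq_iff grad_def pd1 mult_ac)
  have hess: "(\<kappa>\<^sup>2 * \<phi> x) *\<^sub>R outer e = hess \<phi> x" for x
    unfolding hess_def pd1 pd by (simp add: vec_eq_iff outer_def mult_ac power2_eq_square)
  show "C2_closure \<Omega> \<phi>"
    unfolding C2_closure_def pd1 using diff[of 1] diff cont grad hess by (auto simp: mult.assoc)
  show "\<And>x. x \<in> closure \<Omega> \<Longrightarrow> gradc \<Omega> \<phi> x = (\<kappa> * \<phi> x) *\<^sub>R e"
    "\<And>x. x \<in> closure \<Omega> \<Longrightarrow> hessc \<Omega> \<phi> x = (\<kappa>\<^sup>2 * \<phi> x) *\<^sub>R outer e"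
    by (rule gradc_hessc_eq[OF assms(1) cont(1) grad cont(2) hess]; assumption)+
qed

text \<open>This is the ellipticity used for the perturbation. Its Hessian is a multiple of
  \<open>outer (axis k 1)\<close>, so a positive minimum of a single diagonal entry replaces a bound
  for the least eigenvalue.\<close>

lemma Fr_bounds_on_compact:
  assumes "compact S" "S \<subseteq> \<Gamma>" "C1_on \<Gamma> F" "F1 \<Gamma> F"
  shows "\<exists>a>0. \<exists>b>0. \<forall>r\<in>S. a \<le> Fr F r $ k $ k \<and> norm (Fr F r) \<le> b"
proof (cases "S = {}")
  case False
  have cont: "continuous_on S (Fr F)"
    using assms(2,3) continuous_on_subset unfolding C1_on_def by blast
  then have "continuous_on S (\<lambda>r. Fr F r $ k $ k)" by (intro continuous_intros)
  then obtain r0 where r0: "r0 \<in> S" "\<And>r. r \<in> S \<Longrightarrow> Fr F r0 $ k $ k \<le> Fr F r $ k $ k"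
    using continuous_attains_inf[OF assms(1) False] by metis
  have "bounded (Fr F ` S)"
    using compact_continuous_image[OF cont assms(1)] by (rule compact_imp_bounded)
  then obtain b where "0 < b" "\<And>r. r \<in> S \<Longrightarrow> norm (Fr F r) \<le> b"
    unfolding bounded_pos by blast
  moreover have "0 < Fr F r0 $ k $ k"
    using r0(1) assms(2,4) Kplus_diag_pos unfolding F1_def by blast
  ultimately show ?thesis using r0(2) by blast
qed (use zero_less_one in blast)

text \<open>Adding \<open>\<tau> exp(\<kappa> x\<^sub>k)\<close> to \<open>w\<close> changes \<open>F(M\<^sub>u[w])\<close> by at least a multiple of
  \<open>\<tau> \<kappa>\<^sup>2\<close> (ellipticity), while the changes of \<open>A\<close> and \<open>B\<close> are of the order \<open>\<tau> \<kappa>\<close>.\<close>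

lemma strict_subsolution_perturbation:
  fixes \<Omega> :: "(real^'n) set"
  assumes "open \<Omega>" "bounded \<Omega>" "Gamma_set \<Gamma>" "C1_on \<Gamma> F" "F1 \<Gamma> F" "A_smooth \<Omega> A"
    "B_smooth \<Omega> B" "C2_closure \<Omega> w" "F2 \<Gamma> F" "0 < d" "0 < \<epsilon>"
  shows "\<exists>v. C2_closure \<Omega> v \<and> C2_near \<Omega> \<epsilon> v w \<and> (\<exists>d'>0. \<forall>u\<in>admissible_class \<Omega> \<Gamma> A w R d.
    subsolution \<Omega> F A B 0 u w \<longrightarrow> u \<in> admissible_class \<Omega> \<Gamma> A v R d' \<and> subsolution \<Omega> F A B d' u v)"
proof -
  fix k :: 'n
  define e where "e = (axis k 1 :: real^'n)"
  have ne: "norm e = 1" by (simp add: e_def)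
  obtain cw where cw: "\<And>x. x \<in> closure \<Omega> \<Longrightarrow> norm (gradc \<Omega> w x) \<le> cw"
    using C2_closure_bounded[OF assms(1,2,8)] by metis
  obtain \<rho> where \<rho>: "\<And>u x h. u \<in> admissible_class \<Omega> \<Gamma> A w R d \<Longrightarrow> x \<in> closure \<Omega> \<Longrightarrow> h \<in> Sym \<Longrightarrow>
    norm h < d / 2 \<Longrightarrow> Mop \<Omega> A u w x + h \<in> inner_part \<Gamma> \<rho> (d / 2)"
    using admissible_in_inner_part[OF assms(1-3,6,8,10), of R] by metis
  have sub: "inner_part \<Gamma> \<rho> (d / 2) \<subseteq> \<Gamma>"
    using assms(3,10) by (intro inner_part_subset) auto
  obtain a0 a1 where a: "0 < a0" "0 < a1" "\<And>r. r \<in> inner_part \<Gamma> \<rho> (d / 2) \<Longrightarrow> a0 \<le> Fr F r $ k $ k"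
    "\<And>r. r \<in> inner_part \<Gamma> \<rho> (d / 2) \<Longrightarrow> norm (Fr F r) \<le> a1"
    using Fr_bounds_on_compact[OF compact_inner_part sub assms(4,5), of k] by metis
  obtain cA where cA: "0 < cA" "\<And>x z p h. x \<in> closure \<Omega> \<Longrightarrow> \<bar>z\<bar> \<le> max R cw \<Longrightarrow> norm p \<le> max R cw \<Longrightarrow>
    norm h \<le> 1 \<Longrightarrow> norm (A x z (p + h) - A x z p) \<le> cA * norm h"
    using A_lipschitz[OF assms(2,6), of "max R cw"] by blast
  obtain cB where cB: "0 < cB" "\<And>x z p h. x \<in> closure \<Omega> \<Longrightarrow> \<bar>z\<bar> \<le> max R cw \<Longrightarrow> norm p \<le> max R cw \<Longrightarrow>
    norm h \<le> 1 \<Longrightarrow> \<bar>B x z (p + h) - B x z p\<bar> \<le> cB * norm h"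
    using B_lipschitz[OF assms(2,7), of "max R cw"] by blast
  obtain cx where cx: "\<And>x. x \<in> closure \<Omega> \<Longrightarrow> norm x \<le> cx"
    using bounded_closure[OF assms(2)] unfolding bounded_iff by metis
  \<comment> \<open>With this \<kappa> the gain \<open>\<kappa>\<^sup>2 * a0\<close> exceeds the
    losses \<open>\<kappa> * (a1 * cA + cB)\<close> by exactly \<kappa>.\<close>
  define \<kappa> where "\<kappa> = (a1 * cA + cB + 1) / a0"
  have \<kappa>: "0 < \<kappa>" "\<kappa> * a0 = a1 * cA + cB + 1"
    using a cA(1) cB(1) by (simp_all add: \<kappa>_def add_pos_pos)
  define \<phi> where "\<phi> = (\<lambda>y :: real^'n. exp (\<kappa> * y $ k))"
  \<comment> \<open>On the closure \<open>exp (\<kappa> * cx)\<close> bounds \<phi>. The other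
    factors majorise all coefficients by which \<phi> enters the size conditions, so that
    \<open>\<tau> = m / S\<close> meets them together.\<close>
  define S where "S = (1 + \<kappa> + \<kappa>\<^sup>2) * (1 + cA) * exp (\<kappa> * cx)"
  have S: "0 < S" using \<kappa>(1) cA(1) by (simp add: S_def add_pos_pos)
  \<comment> \<open>The bound 1 admits the gradient step to the Lipschitz estimates, \<epsilon>
    gives closeness to \<open>w\<close>, and \<open>d / 4\<close> keeps the change of
    \<open>M_u[w]\<close> well below half of the margin.\<close>
  define m where "m = min 1 (min \<epsilon> (d / 4))"
  have m: "0 < m" "m \<le> 1" "m \<le> \<epsilon>" "m \<le> d / 4" using assms(10,11) by (auto simp: m_def)
  define \<tau> where "\<tau> = m / S"
  have \<tau>: "0 < \<tau>" using m S by (simp add: \<tau>_def)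
  define v where "v = (\<lambda>y. w y + \<tau> * \<phi> y)"
  note \<phi> = C2_closure_exp_coordinate[OF assms(1), where \<kappa> = \<kappa> and k = k, folded \<phi>_def e_def]
  note V = C2_closure_lincomb[OF assms(1,8) \<phi>(1), where c = \<tau>, folded v_def]
  define f where "f = (\<lambda>x. \<tau> * \<phi> x)"
  have gv: "gradc \<Omega> v x = gradc \<Omega> w x + (\<kappa> * f x) *\<^sub>R e"
    and hv: "hessc \<Omega> v x = hessc \<Omega> w x + (\<kappa>\<^sup>2 * f x) *\<^sub>R outer e" if "x \<in> closure \<Omega>" for x
    using V(2,3)[OF that] \<phi>(2,3)[OF that] by (simp_all add: f_def \<phi>_def mult_ac)
  define E0 where "E0 = \<tau> * exp (- (\<kappa> * cx))"
  have E0: "0 < E0" using \<tau> by (simp add: E0_def)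
  have f: "E0 \<le> f x" "0 < f x" "(1 + \<kappa> + \<kappa>\<^sup>2) * (1 + cA) * f x \<le> m" if "x \<in> closure \<Omega>" for x
  proof -
    have "\<bar>x $ k\<bar> \<le> cx" using cx[OF that] abs_component_le_norm[of x k] by linarith
    then have "\<kappa> * - cx \<le> \<kappa> * x $ k" "\<kappa> * x $ k \<le> \<kappa> * cx"
      using \<kappa>(1) by (intro mult_left_mono; linarith)+
    then have \<phi>x: "exp (- (\<kappa> * cx)) \<le> \<phi> x" "\<phi> x \<le> exp (\<kappa> * cx)" by (simp_all add: \<phi>_def)
    show "E0 \<le> f x" using \<phi>x(1) \<tau> by (simp add: E0_def f_def)
    show "0 < f x" using \<tau> by (simp add: f_def \<phi>_def)
    have "f x \<le> \<tau> * exp (\<kappa> * cx)" using \<phi>x(2) \<tau> by (simp add: f_def)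
    then have "(1 + \<kappa> + \<kappa>\<^sup>2) * (1 + cA) * f x \<le> (1 + \<kappa> + \<kappa>\<^sup>2) * (1 + cA) * (\<tau> * exp (\<kappa> * cx))"
      using \<kappa>(1) cA(1) by (intro mult_left_mono) auto
    also have "\<dots> = \<tau> * S" by (simp add: S_def)
    also have "\<dots> = m" using S by (simp add: \<tau>_def)
    finally show "(1 + \<kappa> + \<kappa>\<^sup>2) * (1 + cA) * f x \<le> m" .
  qed
  have small: "f x \<le> m" "\<kappa> * f x \<le> m" "\<kappa>\<^sup>2 * f x \<le> m" "\<kappa>\<^sup>2 * f x + cA * (\<kappa> * f x) \<le> m" if "x \<in> closure \<Omega>" for x
  proof -
    have "0 \<le> \<kappa> * f x" "0 \<le> \<kappa>\<^sup>2 * f x" "0 \<le> cA * f x" "0 \<le> cA * (\<kappa> * f x)" "0 \<le> cA * (\<kappa>\<^sup>2 * f x)"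
      using f(2)[OF that] \<kappa>(1) cA(1) by simp_all
    moreover have "f x + \<kappa> * f x + \<kappa>\<^sup>2 * f x + cA * f x + cA * (\<kappa> * f x) + cA * (\<kappa>\<^sup>2 * f x) \<le> m"
      using f(3)[OF that] by (simp add: algebra_simps)
    ultimately show "f x \<le> m" "\<kappa> * f x \<le> m" "\<kappa>\<^sup>2 * f x \<le> m" "\<kappa>\<^sup>2 * f x + cA * (\<kappa> * f x) \<le> m"
      using f(2)[OF that] by linarith+
  qed
  \<comment> \<open>The first entry is the least strictness gained on the closure, \<open>E0\<close>
    being a lower bound of \<open>f\<close>. The second gives \<open>mat d'\<close> norm at most
    \<open>d / 8\<close>, so that together with \<open>H\<close> it stays below
    \<open>d / 2\<close>.\<close>
  define d' where "d' = min (\<kappa> * E0) (d / (8 * (norm (mat 1 :: real^'n^'n) + 1)))"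
  have n1: "0 < norm (mat 1 :: real^'n^'n) + 1" by (simp add: add_nonneg_pos)
  have d': "0 < d'" "d' \<le> \<kappa> * E0" using \<kappa>(1) E0 assms(10) n1 by (simp_all add: d'_def)
  have "norm (mat d' :: real^'n^'n) \<le> d' * (norm (mat 1 :: real^'n^'n) + 1)"
    using d'(1) by (subst norm_mat) simp
  also have "\<dots> \<le> d / (8 * (norm (mat 1 :: real^'n^'n) + 1)) * (norm (mat 1 :: real^'n^'n) + 1)"
    using n1 by (intro mult_right_mono) (auto simp: d'_def)
  also have "\<dots> = d / 8"
  proof -
    have "d / (8 * b) * b = d / 8" if "0 < b" for b using that by simp
    from this[OF n1] show ?thesis .
  qed
  finally have nd': "norm (mat d' :: real^'n^'n) \<le> d / 8" .
  define H where "H = (\<lambda>u x. (\<kappa>\<^sup>2 * f x) *\<^sub>R outer e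
    - (A x (u x) (gradc \<Omega> w x + (\<kappa> * f x) *\<^sub>R e) - A x (u x) (gradc \<Omega> w x)))"
  have MH: "Mop \<Omega> A u v x = Mop \<Omega> A u w x + H u x" if "x \<in> closure \<Omega>" for u x
    by (simp add: Mop_def H_def gv[OF that] hv[OF that])
  have he: "norm ((\<kappa> * f x) *\<^sub>R e) = \<kappa> * f x" "norm ((\<kappa> * f x) *\<^sub>R e) \<le> 1" if "x \<in> closure \<Omega>" for x
    using small(2)[OF that] f(2)[OF that] \<kappa>(1) m(2) by (simp_all add: ne abs_mult)
  have core: "norm (A x (u x) (gradc \<Omega> w x + (\<kappa> * f x) *\<^sub>R e) - A x (u x) (gradc \<Omega> w x)) \<le> cA * (\<kappa> * f x)"
      "\<bar>B x (u x) (gradc \<Omega> w x + (\<kappa> * f x) *\<^sub>R e) - B x (u x) (gradc \<Omega> w x)\<bar> \<le> cB * (\<kappa> * f x)"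
      "H u x \<in> Sym" "norm (H u x) \<le> d / 4"
    if u: "u \<in> admissible_class \<Omega> \<Gamma> A w R d" and x: "x \<in> closure \<Omega>" for u x
  proof -
    have "C2_closure \<Omega> u" "norm1 \<Omega> u \<le> R" using u by (auto simp: admissible_class_def)
    then have z: "\<bar>u x\<bar> \<le> max R cw" using norm1_bounds(1)[OF assms(1,2) _ _ x] by (simp add: le_max_iff_disj)
    have p: "norm (gradc \<Omega> w x) \<le> max R cw" using cw[OF x] by simp
    show A1: "norm (A x (u x) (gradc \<Omega> w x + (\<kappa> * f x) *\<^sub>R e) - A x (u x) (gradc \<Omega> w x)) \<le> cA * (\<kappa> * f x)"
      using cA(2)[OF x z p he(2)[OF x]] unfolding he(1)[OF x] .
    show "\<bar>B x (u x) (gradc \<Omega> w x + (\<kappa> * f x) *\<^sub>R e) - B x (u x) (gradc \<Omega> w x)\<bar> \<le> cB * (\<kappa> * f x)"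
      using cB(2)[OF x z p he(2)[OF x]] unfolding he(1)[OF x] .
    show "H u x \<in> Sym"
      unfolding H_def using assms(6) x by (intro Sym_diff Sym_scaleR Sym_outer) (auto simp: A_smooth_def)
    have "norm (H u x) \<le> norm ((\<kappa>\<^sup>2 * f x) *\<^sub>R outer e) + cA * (\<kappa> * f x)"
      unfolding H_def using A1 norm_triangle_ineq4 order_trans add_left_mono by blast
    also have "norm ((\<kappa>\<^sup>2 * f x) *\<^sub>R outer e) = \<kappa>\<^sup>2 * f x"
      using f(2)[OF x] by (simp add: norm_outer ne)
    finally show "norm (H u x) \<le> d / 4" using small(4)[OF x] m(4) by linarith
  qed
  show ?thesis
  proof (intro exI[of _ v] conjI V(1), unfold C2_near_def, intro ballI)
    fix x assume "x \<in> \<Omega>"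
    then have x: "x \<in> closure \<Omega>" using closure_subset by blast
    have "grad v x - grad w x = (\<kappa> * f x) *\<^sub>R e" "hess v x - hess w x = (\<kappa>\<^sup>2 * f x) *\<^sub>R outer e"
      using gv[OF x] hv[OF x] C2_closureD(6,7)[OF assms(1,8) \<open>x \<in> \<Omega>\<close>] C2_closureD(6,7)[OF assms(1) V(1) \<open>x \<in> \<Omega>\<close>]
      by (simp_all add: algebra_simps)
    moreover have "v x - w x = f x" by (simp add: v_def f_def)
    ultimately show "\<bar>v x - w x\<bar> \<le> \<epsilon> \<and> norm (grad v x - grad w x) \<le> \<epsilon> \<and> norm (hess v x - hess w x) \<le> \<epsilon>"
      using small[OF x] f(2)[OF x] m(3) he(1)[OF x] by (simp add: norm_outer ne)
  next
    show "\<exists>d'>0. \<forall>u\<in>admissible_class \<Omega> \<Gamma> A w R d. subsolution \<Omega> F A B 0 u w \<longrightarrow>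
      u \<in> admissible_class \<Omega> \<Gamma> A v R d' \<and> subsolution \<Omega> F A B d' u v"
    proof (intro exI[of _ d'] conjI d'(1) ballI impI)
      fix u assume u: "u \<in> admissible_class \<Omega> \<Gamma> A w R d" and ss: "subsolution \<Omega> F A B 0 u w"
      note c = core[OF u]
      have in1: "Mop \<Omega> A u v x \<in> inner_part \<Gamma> \<rho> (d / 2)" if x: "x \<in> closure \<Omega>" for x
        unfolding MH[OF x] using c(3,4)[OF x] assms(10) by (intro \<rho>[OF u x]) auto
      have in2: "Mop \<Omega> A u v x - mat d' \<in> \<Gamma>" if x: "x \<in> closure \<Omega>" for x
      proof -
        have "norm (H u x - mat d') < d / 2"
          using norm_triangle_ineq4[of "H u x" "mat d'"] c(4)[OF x] nd' assms(10) by linarith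
        then have "Mop \<Omega> A u w x + (H u x - mat d') \<in> inner_part \<Gamma> \<rho> (d / 2)"
          by (intro \<rho>[OF u x]) (intro Sym_diff c(3)[OF x] Sym_mat)
        then show ?thesis using sub by (auto simp: MH[OF x] algebra_simps)
      qed
      show "u \<in> admissible_class \<Omega> \<Gamma> A v R d'"
        using u in1 in2 sub unfolding admissible_class_def by blast
      show "subsolution \<Omega> F A B d' u v"
        unfolding subsolution_def
      proof
        fix x assume xo: "x \<in> \<Omega>"
        then have x: "x \<in> closure \<Omega>" using closure_subset by blast
        let ?N = "Mop \<Omega> A u w x" and ?V = "Mop \<Omega> A u v x"
        let ?D = "A x (u x) (gradc \<Omega> w x + (\<kappa> * f x) *\<^sub>R e) - A x (u x) (gradc \<Omega> w x)"
        have g: "grad w x = gradc \<Omega> w x" "grad v x = gradc \<Omega> w x + (\<kappa> * f x) *\<^sub>R e"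
          using gv[OF x] C2_closureD(6)[OF assms(1,8) xo] C2_closureD(6)[OF assms(1) V(1) xo] by simp_all
        have N: "?N \<in> \<Gamma>" using u x by (simp add: admissible_class_def)
        have "?V \<in> \<Gamma>" using in1[OF x] sub by blast
        \<comment> \<open>The tangent is taken at the perturbed matrix, which bounds its value of
          \<open>F\<close> from below. The bounds \<open>a0\<close> and \<open>a1\<close> apply
          there because the perturbed matrix lies in \<open>inner_part\<close>.\<close>
        from concave_tangent[OF assms(4,9) this N]
        have "F ?N + Fr F ?V \<bullet> H u x \<le> F ?V"
          by (simp add: MH[OF x])
        moreover have "Fr F ?V \<bullet> H u x = \<kappa>\<^sup>2 * f x * Fr F ?V $ k $ k - Fr F ?V \<bullet> ?D"
          by (simp add: H_def inner_diff_right inner_outer) (simp add: e_def inner_axis' inner_axis matrix_vector_mul_component)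
        moreover have "\<kappa>\<^sup>2 * f x * a0 \<le> \<kappa>\<^sup>2 * f x * Fr F ?V $ k $ k"
          using a(3)[OF in1[OF x]] f(2)[OF x] by (intro mult_left_mono) auto
        moreover have "Fr F ?V \<bullet> ?D \<le> a1 * (cA * (\<kappa> * f x))"
          using norm_cauchy_schwarz[of "Fr F ?V" ?D] mult_mono[OF a(4)[OF in1[OF x]] c(1)[OF x]] a(2)
          by simp
        moreover have "B x (u x) (grad w x) \<le> F ?N"
          using ss xo by (simp add: subsolution_def)
        moreover have "B x (u x) (grad v x) - B x (u x) (grad w x) \<le> cB * (\<kappa> * f x)"
          using c(2)[OF x] unfolding g by linarith
        moreover have "\<kappa>\<^sup>2 * f x * a0 - a1 * (cA * (\<kappa> * f x)) - cB * (\<kappa> * f x) = \<kappa> * f x"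
        proof -
          have "\<kappa>\<^sup>2 * f x * a0 = \<kappa> * f x * (\<kappa> * a0)" by (simp add: power2_eq_square)
          then show ?thesis unfolding \<kappa>(2) by (simp add: algebra_simps)
        qed
        moreover have "d' \<le> \<kappa> * f x"
          using d'(2) mult_left_mono[OF f(1)[OF x], of \<kappa>] \<kappa>(1) by linarith
        ultimately show "B x (u x) (grad v x) + d' \<le> F ?V" by linarith
      qed
    qed
  qed
qed

theorem lemma2p1:
  fixes \<Omega> :: "(real^'n) set" and \<Gamma> :: "(real^'n^'n) set"
    and F :: "real^'n^'n \<Rightarrow> real"
    and A :: "real^'n \<Rightarrow> real \<Rightarrow> real^'n \<Rightarrow> real^'n^'n"
    and B :: "real^'n \<Rightarrow> real \<Rightarrow> real^'n \<Rightarrow> real"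
    and w :: "real^'n \<Rightarrow> real"
  assumes "open \<Omega>" "connected \<Omega>" "bounded \<Omega>" "\<Omega> \<noteq> {}"
    and "Gamma_set \<Gamma>" "C1_on \<Gamma> F" "F1 \<Gamma> F"
    and "A_smooth \<Omega> A" "A_regular \<Omega> A" "B_smooth \<Omega> B"
    and "C2_closure \<Omega> w"
  shows "(\<forall>R d U. d > 0 \<longrightarrow>
      (F2 \<Gamma> F \<and> U = admissible_class \<Omega> \<Gamma> A w R d) \<or>
      (Fmu \<Gamma> F \<and> U = positive_class \<Omega> \<Gamma> A w R d) \<longrightarrow>
      (\<exists>K>0. \<exists>\<delta>>0. \<exists>C>0.
        (\<forall>m. \<exists>C'>0. \<forall>u\<in>U. (\<forall>x\<in>\<Omega>. m \<le> F (Mop \<Omega> A u u x)) \<longrightarrow>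
           (\<forall>x\<in>\<Omega>. Lop \<Omega> F A u (\<lambda>y. exp (K * (w y - u y))) x
              \<ge> \<delta> * Tr F (Mop \<Omega> A u u x) - C * F (Mop \<Omega> A u u x) - C')) \<and>
        (\<exists>C\<^sub>0>0. \<exists>C'>0. \<forall>u\<in>U. \<forall>x\<in>\<Omega>.
           Lop \<Omega> F A u (\<lambda>y. exp (K * (w y - u y))) x
              \<ge> \<delta> * Tr F (Mop \<Omega> A u u x)
                 - (if F (Mop \<Omega> A u u x) \<ge> 0 then C else C\<^sub>0) * F (Mop \<Omega> A u u x) - C')))
    \<and>
    (F2 \<Gamma> F \<and> B_convex \<Omega> B \<longrightarrow>
      (\<forall>R d. d > 0 \<longrightarrow>
        (\<exists>K>0. \<exists>\<delta>>0. \<forall>u\<in>admissible_class \<Omega> \<Gamma> A w R d.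
          supersolution \<Omega> F A B u \<longrightarrow> subsolution \<Omega> F A B d u w \<longrightarrow>
          (\<forall>x\<in>\<Omega>. LBop \<Omega> F A B u (\<lambda>y. exp (K * (w y - u y))) x
             \<ge> \<delta> * (Tr F (Mop \<Omega> A u u x) + 1)))) \<and>
      (\<forall>R d \<epsilon>. d > 0 \<and> \<epsilon> > 0 \<longrightarrow>
        (\<exists>v. C2_closure \<Omega> v \<and> C2_near \<Omega> \<epsilon> v w \<and>
          (\<exists>d'>0. \<exists>K>0. \<exists>\<delta>>0. \<forall>u\<in>admissible_class \<Omega> \<Gamma> A w R d.
            supersolution \<Omega> F A B u \<longrightarrow> subsolution \<Omega> F A B 0 u w \<longrightarrow>
            u \<in> admissible_class \<Omega> \<Gamma> A v R d' \<and> subsolution \<Omega> F A B d' u v \<and>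
            (\<forall>x\<in>\<Omega>. LBop \<Omega> F A B u (\<lambda>y. exp (K * (v y - u y))) x
               \<ge> \<delta> * (Tr F (Mop \<Omega> A u u x) + 1))))))"
proof (intro conjI allI impI)
  fix R d :: real and U
  assume d: "0 < d" and *: "(F2 \<Gamma> F \<and> U = admissible_class \<Omega> \<Gamma> A w R d) \<or>
    (Fmu \<Gamma> F \<and> U = positive_class \<Omega> \<Gamma> A w R d)"
  obtain s c where s: "0 < s" "\<And>u x. u \<in> U \<Longrightarrow> x \<in> \<Omega> \<Longrightarrow> s * Tr F (Mop \<Omega> A u u x) - F (Mop \<Omega> A u u x) - c
      \<le> Fr F (Mop \<Omega> A u u x) \<bullet> (Mop \<Omega> A u w x - Mop \<Omega> A u u x)"
    using *
  proof
    assume a: "F2 \<Gamma> F \<and> U = admissible_class \<Omega> \<Gamma> A w R d"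
    obtain s where s: "0 < s" "\<And>u x. u \<in> U \<Longrightarrow> x \<in> \<Omega> \<Longrightarrow>
      s * Tr F (Mop \<Omega> A u u x) + F (Mop \<Omega> A u w x) - F (Mop \<Omega> A u u x) - 1
        \<le> Fr F (Mop \<Omega> A u u x) \<bullet> (Mop \<Omega> A u w x - Mop \<Omega> A u u x)"
      \<comment> \<open>An additive loss is harmless in part (i), so \<open>\<theta> = 1\<close> is
        taken and moved into the constant.\<close>
      using concave_bracket[OF assms(1,3,5,6) conjunct1[OF a] assms(8,11) d zero_less_one, of R] a by blast
    obtain c where c: "\<And>u x. u \<in> U \<Longrightarrow> x \<in> \<Omega> \<Longrightarrow> - c \<le> F (Mop \<Omega> A u w x)"
      using F_bounded_below[OF assms(1,3,5,6,8,11) d, of R] a by blast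
    show thesis
    proof (rule that[OF s(1), of "c + 1"])
      fix u x assume "u \<in> U" "x \<in> \<Omega>"
      from s(2)[OF this] c[OF this]
      show "s * Tr F (Mop \<Omega> A u u x) - F (Mop \<Omega> A u u x) - (c + 1)
        \<le> Fr F (Mop \<Omega> A u u x) \<bullet> (Mop \<Omega> A u w x - Mop \<Omega> A u u x)" by linarith
    qed
  next
    assume b: "Fmu \<Gamma> F \<and> U = positive_class \<Omega> \<Gamma> A w R d"
    with that[of "d / 2"] d show thesis
      using Fmu_bracket[OF assms(7) conjunct1[OF b] d, of \<Omega> A w R] by auto
  qed
  have U: "u \<in> U \<Longrightarrow> C2_closure \<Omega> u" "u \<in> U \<Longrightarrow> norm1 \<Omega> u \<le> R"
    "u \<in> U \<Longrightarrow> x \<in> \<Omega> \<Longrightarrow> Mop \<Omega> A u u x \<in> \<Gamma>" for u x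
    using * closure_subset[of \<Omega>] unfolding admissible_class_def positive_class_def by blast+
  show "\<exists>K>0. \<exists>\<delta>>0. \<exists>C>0.
        (\<forall>m. \<exists>C'>0. \<forall>u\<in>U. (\<forall>x\<in>\<Omega>. m \<le> F (Mop \<Omega> A u u x)) \<longrightarrow>
           (\<forall>x\<in>\<Omega>. Lop \<Omega> F A u (\<lambda>y. exp (K * (w y - u y))) x
              \<ge> \<delta> * Tr F (Mop \<Omega> A u u x) - C * F (Mop \<Omega> A u u x) - C')) \<and>
        (\<exists>C\<^sub>0>0. \<exists>C'>0. \<forall>u\<in>U. \<forall>x\<in>\<Omega>.
           Lop \<Omega> F A u (\<lambda>y. exp (K * (w y - u y))) x
              \<ge> \<delta> * Tr F (Mop \<Omega> A u u x)
                 - (if F (Mop \<Omega> A u u x) \<ge> 0 then C else C\<^sub>0) * F (Mop \<Omega> A u u x) - C')"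
    by (rule estimate_i[OF assms(1,3,7,8,9,11) s(1) U s(2)])
next
  fix R d :: real
  assume "F2 \<Gamma> F \<and> B_convex \<Omega> B" "0 < d"
  then show "\<exists>K>0. \<exists>\<delta>>0. \<forall>u\<in>admissible_class \<Omega> \<Gamma> A w R d.
          supersolution \<Omega> F A B u \<longrightarrow> subsolution \<Omega> F A B d u w \<longrightarrow>
          (\<forall>x\<in>\<Omega>. LBop \<Omega> F A B u (\<lambda>y. exp (K * (w y - u y))) x
             \<ge> \<delta> * (Tr F (Mop \<Omega> A u u x) + 1))"
    using estimate_ii[OF assms(1,3,5-11)] by blast
next
  fix R d \<epsilon> :: real
  assume FB: "F2 \<Gamma> F \<and> B_convex \<Omega> B" and pos: "0 < d \<and> 0 < \<epsilon>"
  obtain v d' where v: "C2_closure \<Omega> v" "C2_near \<Omega> \<epsilon> v w" "0 < d'" "\<And>u. u\<in>admissible_class \<Omega> \<Gamma> A w R d \<Longrightarrow>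
    subsolution \<Omega> F A B 0 u w \<Longrightarrow> u \<in> admissible_class \<Omega> \<Gamma> A v R d' \<and> subsolution \<Omega> F A B d' u v"
    using strict_subsolution_perturbation[OF assms(1,3,5-8,10,11) conjunct1[OF FB] conjunct1[OF pos] conjunct2[OF pos], of R]
    by blast
  \<comment> \<open>The strict estimate is applied to \<open>v\<close> and its new margin
    \<open>d'\<close>. Since \<open>v\<close> was chosen before \<open>u\<close>, the resulting
    \<open>K\<close> and \<delta> are still uniform.\<close>
  from estimate_ii[OF assms(1,3,5-10) v(1) conjunct1[OF FB] conjunct2[OF FB] v(3), of R]
  obtain K \<delta> where K: "0 < K" "0 < \<delta>" "\<And>u x. u\<in>admissible_class \<Omega> \<Gamma> A v R d' \<Longrightarrow>
    supersolution \<Omega> F A B u \<Longrightarrow> subsolution \<Omega> F A B d' u v \<Longrightarrow> x \<in> \<Omega> \<Longrightarrow>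
    \<delta> * (Tr F (Mop \<Omega> A u u x) + 1) \<le> LBop \<Omega> F A B u (\<lambda>y. exp (K * (v y - u y))) x"
    by blast
  show "\<exists>v. C2_closure \<Omega> v \<and> C2_near \<Omega> \<epsilon> v w \<and>
          (\<exists>d'>0. \<exists>K>0. \<exists>\<delta>>0. \<forall>u\<in>admissible_class \<Omega> \<Gamma> A w R d.
            supersolution \<Omega> F A B u \<longrightarrow> subsolution \<Omega> F A B 0 u w \<longrightarrow>
            u \<in> admissible_class \<Omega> \<Gamma> A v R d' \<and> subsolution \<Omega> F A B d' u v \<and>
            (\<forall>x\<in>\<Omega>. LBop \<Omega> F A B u (\<lambda>y. exp (K * (v y - u y))) x
               \<ge> \<delta> * (Tr F (Mop \<Omega> A u u x) + 1)))"
    using v K by blast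
qed

end
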